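(* Let $P_{S_eS}$ be the joint distribution of side information and state, let $P_{YZ|XS}$ be the channel, and let $d$ be the distortion measure. For $D\ge 0$ let $R(D,0)$ be the set of all pairs $(R,R_c)\in\mathbb{R}^2$ with $R\ge 0$, $R_c\ge 0$ for which there exists $P_{S_eSUXYZ\hat S}\in\mathcal{P}$ such that $$R\le I(U;Y)-I(U;S_e),\qquad R_c\ge \max\{I(U;\hat S)-I(U;Y),\,0\},\qquad D\ge \mathbb{E}[d(S,\hat S)].$$ Then $R(D,0)$ is an inner bound of the common-randomness-assisted distribution-preserving capacity-distortion region: every $(R,R_c)\in R(D,0)$ belongs to the $(D,0)$-capacity-distortion region.
   Context: All alphabets $\mathcal{S}_e,\mathcal{S}=\hat{\mathcal{S}},\mathcal{X},\mathcal{Y},\mathcal{Z}$ are finite. Given are a distribution $P_{S_eS}$ on $\mathcal{S}_e\times\mathcal{S}$ with marginal $P_S$, a channel $P_{YZ|XS}$, and a distortion measure $d:\mathcal{S}\times\hat{\mathcal{S}}\to[0,\infty)$ with $d(s^n,\hat s^n)=\frac1n\sum_{i=1}^n d(s_i,\hat s_i)$. The pairs $(S_{e,i},S_i)$, $i=1,\dots,n$, are i.i.d. $\sim P_{S_eS}$, and the channel is memoryless: given $X^n,S^n$, the pair $(Y^n,Z^n)$ has law $\prod_i P_{YZ|XS}$. $Y^n$ is the receiver's channel output, and $Z^n$ is feedback available to the state estimator at the sender. An $(n,R,R_c)$ common-randomness (CR)-assisted code consists of: a message $M$ uniform on $\mathcal{M}=[1:2^{nR}]$; common randomness $\Gamma$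 uniform on $[1:2^{nR_c}]$, available to encoder, decoder and state estimator ($M$, $\Gamma$, $(S_e^n,S^n)$ are independent); a (possibly stochastic) encoder mapping $(M,S_e^n,\Gamma)$ to $X^n\in\mathcal{X}^n$ (so $S_e^n$ is known noncausally); a decoder mapping $(Y^n,\Gamma)$ to $\hat M\in\mathcal{M}$; and a (possibly stochastic) state estimator mapping $(\Gamma,X^n,S_e^n,Z^n)$ to $\hat S^n\in\hat{\mathcal{S}}^n$. With $\|\cdot\|$ denoting total variation, $(R,R_c)$ is $(D,\Delta)$-achievable if for every $\epsilon>0$ and all sufficiently large $n$ there is an $(n,R,R_c)$ code with $\Pr\{M\ne\hat M\}\le\epsilon$, $\mathbb{E}[d(S^n,\hat S^n)]\le D$ and $\|P_{\hat S^n}-P_S^n\|\le\Delta$, where $P_S^n=\prod_{i=1}^nP_S$. For $\Delta=0$ the last condition means $P_{\hat S^n}=P_S^n$ exactly. The $(D,0)$-capacity-distortion region is the set of $(R,R_c)$ such that $(R,R_c,D)$ lies in the closure of the set of triples $(R',R_c',D')$ for which $(R',R_c')$ is $(D',0)$-achievable. $\mathcal{P}(U,X,\hat S)$ is the set of joint distributions (with $U$ an auxiliary variable on some finite alphabet) of the form $$P_{S_eS}(s_e,s)\,P_{U|S_e}(u|s_e)\,P_{X|US_e}(x|u,s_e)\,P_{YZ|XS}(y,z|x,s)\,P_{\hat S|XS_eZ}(\hat s|x,s_e,z),$$ with $P_{S_eS}$ and $P_{YZ|XS}$ the given ones, and $\mathcal{P}$ is the subset of those with $P_{\hat S}=P_S$.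 *)

theory Defs
  imports "HOL-Probability.Probability"
begin

text \<open>
  All alphabets are types of class \<open>finite\<close>, except that of the auxiliary variable, which is
  an arbitrary finite set of natural numbers (so that it can be quantified existentially).
  A sequence of length \<open>n\<close> is a function on \<open>{..<n}\<close> that is \<open>undefined\<close> elsewhere; this is
  exactly the support of \<open>Pi_pmf {..<n} undefined\<close> over a finite alphabet. Without this
  restriction an encoder could pass information to the estimator through the values outside
  \<open>{..<n}\<close>.
\<close>

abbreviation seqs :: "nat \<Rightarrow> (nat \<Rightarrow> 'a) set" where
  "seqs n \<equiv> {..<n} \<rightarrow>\<^sub>E UNIV"

definition iid_pmf :: "nat \<Rightarrow> 'a pmf \<Rightarrow> (nat \<Rightarrow> 'a) pmf" where
  "iid_pmf n p = Pi_pmf {..<n} undefined (\<lambda>_. p)"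

text \<open>The set \<open>[1:2^(nR)]\<close>: all integers \<open>k\<close> with \<open>1 \<le> k \<le> 2^(nR)\<close>.\<close>

definition index_set :: "nat \<Rightarrow> real \<Rightarrow> nat set" where
  "index_set n R = {1..nat \<lfloor>2 powr (real n * R)\<rfloor>}"

definition block_distortion :: "('s \<Rightarrow> 's \<Rightarrow> real) \<Rightarrow> nat \<Rightarrow> (nat \<Rightarrow> 's) \<Rightarrow> (nat \<Rightarrow> 's) \<Rightarrow> real" where
  "block_distortion d n s t = (\<Sum>i<n. d (s i) (t i)) / real n"

definition total_variation :: "'a pmf \<Rightarrow> 'a pmf \<Rightarrow> real" where
  "total_variation p q = (SUP A. \<bar>measure_pmf.prob p A - measure_pmf.prob q A\<bar>)"

lemma total_variation_le_0_iff: "total_variation p q \<le> 0 \<longleftrightarrow> p = q"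
proof
  assume le: "total_variation p q \<le> 0"
  have bdd: "bdd_above (range (\<lambda>A. \<bar>measure_pmf.prob p A - measure_pmf.prob q A\<bar>))"
  proof (rule bdd_aboveI2)
    fix A
    show "\<bar>measure_pmf.prob p A - measure_pmf.prob q A\<bar> \<le> 1"
      using measure_pmf.prob_le_1[of p A] measure_pmf.prob_le_1[of q A]
        measure_nonneg[of p A] measure_nonneg[of q A] by linarith
  qed
  show "p = q"
  proof (rule pmf_eqI)
    fix x
    have "\<bar>measure_pmf.prob p {x} - measure_pmf.prob q {x}\<bar> \<le> total_variation p q"
      unfolding total_variation_def by (rule cSUP_upper[OF _ bdd]) simp
    then show "pmf p x = pmf q x" using le by (simp add: measure_pmf_single)
  qed
qed (simp add: total_variation_def)

text \<open>
  Arguments: encoder \<open>(M, Se^n, \<Gamma>)\<close>, decoder \<open>(Y^n, \<Gamma>)\<close>, state estimator \<open>(\<Gamma>, X^n, Se^n, Z^n)\<close>.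
\<close>

record ('se, 's, 'x, 'y, 'z) cr_code =
  enc :: "nat \<Rightarrow> (nat \<Rightarrow> 'se) \<Rightarrow> nat \<Rightarrow> (nat \<Rightarrow> 'x) pmf"
  dec :: "(nat \<Rightarrow> 'y) \<Rightarrow> nat \<Rightarrow> nat"
  est :: "nat \<Rightarrow> (nat \<Rightarrow> 'x) \<Rightarrow> (nat \<Rightarrow> 'se) \<Rightarrow> (nat \<Rightarrow> 'z) \<Rightarrow> (nat \<Rightarrow> 's) pmf"

definition is_cr_code :: "nat \<Rightarrow> real \<Rightarrow> real \<Rightarrow> ('se, 's, 'x, 'y, 'z) cr_code \<Rightarrow> bool" where
  "is_cr_code n R Rc c \<longleftrightarrow>
     (\<forall>m\<in>index_set n R. \<forall>se\<in>seqs n. \<forall>g\<in>index_set n Rc. set_pmf (enc c m se g) \<subseteq> seqs n) \<and>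
     (\<forall>y\<in>seqs n. \<forall>g\<in>index_set n Rc. dec c y g \<in> index_set n R) \<and>
     (\<forall>g\<in>index_set n Rc. \<forall>x\<in>seqs n. \<forall>se\<in>seqs n. \<forall>z\<in>seqs n.
        set_pmf (est c g x se z) \<subseteq> seqs n)"

text \<open>
  The joint law of \<open>(M, M', S^n, Sh^n)\<close>. The default value \<open>(undefined, undefined)\<close> makes both
  component sequences \<open>undefined\<close> outside \<open>{..<n}\<close>.
\<close>

definition code_pmf ::
  "('se \<times> 's) pmf \<Rightarrow> ('x \<Rightarrow> 's \<Rightarrow> ('y \<times> 'z) pmf) \<Rightarrow> nat \<Rightarrow> real \<Rightarrow> real
    \<Rightarrow> ('se, 's, 'x, 'y, 'z) cr_code \<Rightarrow> (nat \<times> nat \<times> (nat \<Rightarrow> 's) \<times> (nat \<Rightarrow> 's)) pmf" where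
  "code_pmf P W n R Rc c = do {
     m \<leftarrow> pmf_of_set (index_set n R);
     g \<leftarrow> pmf_of_set (index_set n Rc);
     ss \<leftarrow> Pi_pmf {..<n} (undefined, undefined) (\<lambda>_. P);
     x \<leftarrow> enc c m (fst \<circ> ss) g;
     yz \<leftarrow> Pi_pmf {..<n} (undefined, undefined) (\<lambda>i. W (x i) (snd (ss i)));
     sh \<leftarrow> est c g x (fst \<circ> ss) (snd \<circ> yz);
     return_pmf (m, dec c (fst \<circ> yz) g, snd \<circ> ss, sh)
   }"

definition achievable ::
  "('se \<times> 's) pmf \<Rightarrow> ('x \<Rightarrow> 's \<Rightarrow> ('y \<times> 'z) pmf) \<Rightarrow> ('s \<Rightarrow> 's \<Rightarrow> real)
    \<Rightarrow> real \<Rightarrow> real \<Rightarrow> real \<Rightarrow> real \<Rightarrow> bool" where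
  "achievable P W d D \<Delta> R Rc \<longleftrightarrow>
     0 \<le> R \<and> 0 \<le> Rc \<and>
     (\<forall>\<epsilon>>0. eventually (\<lambda>n. \<exists>c :: ('se, 's, 'x, 'y, 'z) cr_code.
        is_cr_code n R Rc c \<and>
        (let J = code_pmf P W n R Rc c in
           measure_pmf.prob J {(m, mh, s, sh). m \<noteq> mh} \<le> \<epsilon> \<and>
           measure_pmf.expectation J (\<lambda>(m, mh, s, sh). block_distortion d n s sh) \<le> D \<and>
           total_variation (map_pmf (\<lambda>(m, mh, s, sh). sh) J) (iid_pmf n (map_pmf snd P)) \<le> \<Delta>))
      sequentially)"

definition capacity_distortion_region ::
  "('se \<times> 's) pmf \<Rightarrow> ('x \<Rightarrow> 's \<Rightarrow> ('y \<times> 'z) pmf) \<Rightarrow> ('s \<Rightarrow> 's \<Rightarrow> real) \<Rightarrow> real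
    \<Rightarrow> (real \<times> real) set" where
  "capacity_distortion_region P W d D =
     {(R, Rc). (R, Rc, D) \<in> closure {(R', Rc', D'). achievable P W d D' 0 R' Rc'}}"

text \<open>Tuples are ordered as \<open>(Se, S, U, X, Y, Z, Sh)\<close>.\<close>

definition joint_laws ::
  "('se \<times> 's) pmf \<Rightarrow> ('x \<Rightarrow> 's \<Rightarrow> ('y \<times> 'z) pmf)
    \<Rightarrow> ('se \<times> 's \<times> nat \<times> 'x \<times> 'y \<times> 'z \<times> 's) pmf set" where
  "joint_laws P W = {J. \<exists>\<U> PU PX PSh.
     finite \<U> \<and> (\<forall>se. set_pmf (PU se) \<subseteq> \<U>) \<and>
     J = do {
       (se, s) \<leftarrow> P;
       u \<leftarrow> PU se;
       x \<leftarrow> PX u se;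
       (y, z) \<leftarrow> W x s;
       sh \<leftarrow> PSh x se z;
       return_pmf (se, s, u, x, y, z, sh)
     }}"

definition preserving_joint_laws ::
  "('se \<times> 's) pmf \<Rightarrow> ('x \<Rightarrow> 's \<Rightarrow> ('y \<times> 'z) pmf)
    \<Rightarrow> ('se \<times> 's \<times> nat \<times> 'x \<times> 'y \<times> 'z \<times> 's) pmf set" where
  "preserving_joint_laws P W =
     {J \<in> joint_laws P W. map_pmf (\<lambda>(se, s, u, x, y, z, sh). sh) J = map_pmf snd P}"

text \<open>Mutual information of two discrete random variables on the probability space \<open>J\<close>, in bits.\<close>

abbreviation mutual_info :: "'a pmf \<Rightarrow> ('a \<Rightarrow> 'b) \<Rightarrow> ('a \<Rightarrow> 'c) \<Rightarrow> real" where
  "mutual_info J A B \<equiv>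
     prob_space.mutual_information (measure_pmf J) 2 (count_space UNIV) (count_space UNIV) A B"

definition inner_region ::
  "('se \<times> 's) pmf \<Rightarrow> ('x \<Rightarrow> 's \<Rightarrow> ('y \<times> 'z) pmf) \<Rightarrow> ('s \<Rightarrow> 's \<Rightarrow> real) \<Rightarrow> real
    \<Rightarrow> (real \<times> real) set" where
  "inner_region P W d D = {(R, Rc). 0 \<le> R \<and> 0 \<le> Rc \<and>
     (\<exists>J \<in> preserving_joint_laws P W.
        let Se = (\<lambda>(se, s, u, x, y, z, sh). se);
            S = (\<lambda>(se, s, u, x, y, z, sh). s);
            U = (\<lambda>(se, s, u, x, y, z, sh). u);
            Y = (\<lambda>(se, s, u, x, y, z, sh). y);
            Sh = (\<lambda>(se, s, u, x, y, z, sh). sh)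
        in R \<le> mutual_info J U Y - mutual_info J U Se \<and>
           Rc \<ge> max (mutual_info J U Sh - mutual_info J U Y) 0 \<and>
           D \<ge> measure_pmf.expectation J (\<lambda>\<omega>. d (S \<omega>) (Sh \<omega>)))}"

end

theory Submission
  imports Defs
begin

text \<open>
  Codewords \<open>U^n(m, l, g)\<close>, with \<open>m\<close> the message, \<open>g\<close> the common randomness and \<open>l\<close> a bin index
  of rate slightly above \<open>I(U;S_e)\<close>, are drawn independently from \<open>P_U\<close>. Given \<open>S_e^n\<close>, a
  likelihood encoder picks \<open>l\<close> with probability proportional to the density ratio of
  \<open>(U^n, S_e^n)\<close>; by soft covering, the induced law is close to the ideal one in which
  \<open>(m, l, g)\<close> is uniform and everything else is produced from the codeword by the memoryless
  conditional law given \<open>U\<close>. For the ideal law the expected distortion, averaged over the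
  codebooks, is the single-letter one, a threshold decoder recovers \<open>(m, l)\<close> if their total rate is
  below \<open>I(U;Y)\<close>, and a second soft covering over all of \<open>(m, l, g)\<close> brings the law of the
  reconstruction close to \<open>P_S^n\<close>. Finally the estimator composes its output with an optimal
  coupling: this makes the law of the reconstruction exactly \<open>P_S^n\<close>, at a cost in distortion that
  is bounded by a multiple of the total variation distance.
\<close>

subsection \<open>Expectations over finitely supported laws\<close>

text \<open>The bin rate is pulled in three directions: covering S_e^n within a bin wants it above
  I(U;S_e), decoding wants it below I(U;Y) - R, and covering the reconstruction wants the total
  rate, R_c included, above I(U;Sh). It is therefore taken about as large as decoding allows; what
  then remains to be asked is that R_c exceed I(U;Sh) - I(U;Y).

  The coding analysis is one-shot: a block counts as a single letter of an arbitrary finitely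
  supported law, and the blocklength enters only through the concentration of the density ratio and
  the sizes of the index sets.

  Soft covering yields an approximate output law, whereas \<Delta> = 0 asks for equality. The repair
  can be left to the estimator because only the overall law of the reconstruction is prescribed, and
  that law is determined once the codebook is fixed.

  The mean distortion may be arbitrarily close to the permitted one, so Markov's inequality gives no
  useful bound on the codebooks that violate it. This is why distortion and errors are not treated
  separately when a codebook is selected.\<close>

abbreviation \<E> :: "'a pmf \<Rightarrow> ('a \<Rightarrow> real) \<Rightarrow> real" where
  "\<E> \<equiv> measure_pmf.expectation"

lemma \<E>_cong: "(\<And>x. x \<in> set_pmf p \<Longrightarrow> f x = g x) \<Longrightarrow> \<E> p f = \<E> p g"
  by (intro integral_cong_AE) (auto simp: AE_measure_pmf_iff)

lemma \<E>_eq_sum: "finite (set_pmf p) \<Longrightarrow> \<E> p f = (\<Sum>x\<in>set_pmf p. pmf p x * f x)"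
  by (subst integral_measure_pmf[of "set_pmf p"]) auto

lemma \<E>_mono:
  assumes "finite (set_pmf p)" "\<And>x. x \<in> set_pmf p \<Longrightarrow> f x \<le> g x"
  shows "\<E> p f \<le> \<E> p g"
  using assms by (simp add: \<E>_eq_sum sum_mono mult_left_mono)

lemma \<E>_nonneg: "(\<And>x. x \<in> set_pmf p \<Longrightarrow> 0 \<le> f x) \<Longrightarrow> 0 \<le> \<E> p f"
  by (intro integral_nonneg_AE) (auto simp: AE_measure_pmf_iff)

lemma \<E>_const: "\<E> p (\<lambda>_. c) = c"
  by simp

lemma \<E>_add: "finite (set_pmf p) \<Longrightarrow> \<E> p (\<lambda>x. f x + g x) = \<E> p f + \<E> p g"
  by (simp add: \<E>_eq_sum algebra_simps sum.distrib)

lemma \<E>_diff: "finite (set_pmf p) \<Longrightarrow> \<E> p (\<lambda>x. f x - g x) = \<E> p f - \<E> p g"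
  by (simp add: \<E>_eq_sum algebra_simps sum_subtractf)

lemma \<E>_sum: "finite (set_pmf p) \<Longrightarrow> \<E> p (\<lambda>x. \<Sum>i\<in>A. f i x) = (\<Sum>i\<in>A. \<E> p (f i))"
  by (simp add: \<E>_eq_sum sum_distrib_left) (rule sum.swap)

lemma \<E>_le_const:
  assumes "finite (set_pmf p)" "\<And>x. x \<in> set_pmf p \<Longrightarrow> f x \<le> c"
  shows "\<E> p f \<le> c"
  using \<E>_mono[of p f "\<lambda>_. c"] assms by simp

lemma \<E>_swap:
  assumes "finite (set_pmf p)" "finite (set_pmf q)"
  shows "\<E> p (\<lambda>x. \<E> q (\<lambda>y. f x y)) = \<E> q (\<lambda>y. \<E> p (\<lambda>x. f x y))"
proof -
  have "\<E> p (\<lambda>x. \<E> q (\<lambda>y. f x y)) =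
      (\<Sum>x\<in>set_pmf p. \<Sum>y\<in>set_pmf q. pmf p x * (pmf q y * f x y))"
    using assms by (simp add: \<E>_eq_sum sum_distrib_left)
  also have "\<dots> = (\<Sum>y\<in>set_pmf q. \<Sum>x\<in>set_pmf p. pmf q y * (pmf p x * f x y))"
    by (subst sum.swap) (simp add: mult_ac)
  also have "\<dots> = \<E> q (\<lambda>y. \<E> p (\<lambda>x. f x y))"
    using assms by (simp add: \<E>_eq_sum sum_distrib_left)
  finally show ?thesis .
qed

lemma \<E>_bind:
  assumes "finite (set_pmf p)" "\<And>x. x \<in> set_pmf p \<Longrightarrow> finite (set_pmf (f x))"
  shows "\<E> (bind_pmf p f) h = \<E> p (\<lambda>x. \<E> (f x) h)"
  using assms by (subst pmf_expectation_bind[of "set_pmf p"]) (auto simp: \<E>_eq_sum)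

lemma \<E>_eq_point: "\<E> p (\<lambda>x. if x = b then c x else 0) = pmf p b * c b"
  by (subst integral_measure_pmf[of "{b}"]) (auto split: if_splits)

lemma \<E>_of_bool: "\<E> p (\<lambda>x. of_bool (Q x)) = measure_pmf.prob p {x. Q x}"
proof -
  have "\<E> p (\<lambda>x. of_bool (Q x)) = \<E> p (indicator {x. Q x})"
    by (rule \<E>_cong) (simp add: indicator_def)
  then show ?thesis by simp
qed

text \<open>Derandomization: this extracts a codebook from a bound on a mean over codebooks.\<close>

lemma exists_le_\<E>:
  assumes "finite (set_pmf p)" "\<E> p f \<le> c"
  shows "\<exists>x\<in>set_pmf p. f x \<le> c"
proof (rule ccontr)
  assume "\<not> ?thesis"
  then have *: "\<And>x. x \<in> set_pmf p \<Longrightarrow> c < f x" by force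
  have "(\<Sum>x\<in>set_pmf p. pmf p x * c) < (\<Sum>x\<in>set_pmf p. pmf p x * f x)"
    using assms(1) * set_pmf_not_empty
    by (intro sum_strict_mono) (auto simp: pmf_positive)
  moreover have "(\<Sum>x\<in>set_pmf p. pmf p x * c) = c"
    using \<E>_eq_sum[OF assms(1), of "\<lambda>_. c"] by simp
  ultimately show False using assms by (simp add: \<E>_eq_sum)
qed

subsection \<open>Independent codewords\<close>

lemma finite_set_Pi_pmf:
  assumes "finite I" "\<And>i. i \<in> I \<Longrightarrow> finite (set_pmf (p i))"
  shows "finite (set_pmf (Pi_pmf I d p))"
  using assms by (auto simp: set_Pi_pmf intro!: finite_PiE_dflt)

lemma \<E>_Pi_component:
  assumes "finite I" "i \<in> I"
  shows "\<E> (Pi_pmf I d p) (\<lambda>C. k (C i)) = \<E> (p i) k"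
proof -
  have "\<E> (Pi_pmf I d p) (\<lambda>C. k (C i)) = \<E> (map_pmf (\<lambda>C. C i) (Pi_pmf I d p)) k" by simp
  then show ?thesis using assms by (simp add: Pi_pmf_component)
qed

lemma \<E>_Pi_two_components:
  assumes "finite I" "i \<in> I" "j \<in> I" "i \<noteq> j" and fin: "\<And>i. i \<in> I \<Longrightarrow> finite (set_pmf (p i))"
  shows "\<E> (Pi_pmf I d p) (\<lambda>C. k (C i) * h (C j)) = \<E> (p i) k * \<E> (p j) h"
proof -
  have I: "I = insert i (I - {i})" using assms by auto
  have f: "finite (set_pmf (Pi_pmf (I - {i}) d p))"
    using assms by (intro finite_set_Pi_pmf) auto
  have "\<E> (Pi_pmf (insert i (I - {i})) d p) (\<lambda>C. k (C i) * h (C j)) =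
      \<E> (p i) (\<lambda>y. \<E> (Pi_pmf (I - {i}) d p) (\<lambda>f. k y * h (f j)))"
    using assms f by (subst Pi_pmf_insert') (auto simp: \<E>_bind)
  also have "\<dots> = \<E> (p i) (\<lambda>y. k y * \<E> (p j) h)"
    using assms by (simp add: \<E>_Pi_component)
  finally show ?thesis using I by simp
qed

text \<open>Independence removes the cross terms of the squared centred sum, so its mean is at most
  \<open>N * T\<close>. The passage from the second to the first absolute moment uses
  \<open>\<bar>x\<bar> \<le> x * x / (2 * c) + c / 2\<close>.\<close>

lemma \<E>_empirical_mean_deviation:
  fixes q :: "'a pmf" and h :: "'a \<Rightarrow> real"
  assumes fin: "finite (set_pmf q)" and I: "finite I" "A \<subseteq> I" "A \<noteq> {}" and "T > 0"
    and T: "\<E> q (\<lambda>u. h u * h u) \<le> T"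
  shows "\<E> (Pi_pmf I d (\<lambda>_. q)) (\<lambda>C. \<bar>\<E> q h - (\<Sum>i\<in>A. h (C i)) / real (card A)\<bar>) \<le> sqrt (T / card A)"
proof -
  let ?P = "Pi_pmf I d (\<lambda>_. q)"
  define N where "N = real (card A)"
  have finA: "finite A" using I finite_subset by blast
  have N: "N > 0" using I finA by (auto simp: N_def card_gt_0_iff)
  define \<mu> where "\<mu> = \<E> q h"
  define k where "k u = h u - \<mu>" for u
  have finP: "finite (set_pmf ?P)" using fin I by (intro finite_set_Pi_pmf) auto
  have k0: "\<E> q k = 0" unfolding k_def using fin by (simp add: \<E>_diff \<mu>_def)
  have "\<E> q (\<lambda>u. k u * k u) = \<E> q (\<lambda>u. h u * h u - 2 * \<mu> * h u + \<mu> * \<mu>)"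
    by (simp add: k_def algebra_simps)
  also have "\<dots> = \<E> q (\<lambda>u. h u * h u) - \<mu> * \<mu>"
    using fin by (simp add: \<E>_add \<E>_diff) (simp add: \<mu>_def)
  also have "\<dots> \<le> T" using T by (simp add: add_increasing2 diff_le_eq)
  finally have var: "\<E> q (\<lambda>u. k u * k u) \<le> T" .
  \<comment> \<open>The value that minimises \<open>(T / N) / (2 * c) + c / 2\<close>; both terms
    become \<open>c / 2\<close>.\<close>
  define c where "c = sqrt (T / N)"
  have c: "c > 0" using N \<open>T > 0\<close> by (simp add: c_def)
  have cc: "c * c = T / N" using N \<open>T > 0\<close> by (simp add: c_def)
  have off: "\<E> ?P (\<lambda>C. k (C i) * k (C j)) = (if i = j then \<E> q (\<lambda>u. k u * k u) else 0)"
    if "i \<in> A" "j \<in> A" for i j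
  proof (cases "i = j")
    case True
    then show ?thesis using I that \<E>_Pi_component[of I i d "\<lambda>_. q" "\<lambda>u. k u * k u"] by auto
  next
    case False
    then show ?thesis using I that k0 fin
        \<E>_Pi_two_components[of I i j "\<lambda>_. q" d k k] by auto
  qed
  have "\<E> ?P (\<lambda>C. (\<Sum>i\<in>A. k (C i)) * (\<Sum>i\<in>A. k (C i))) = (\<Sum>i\<in>A. \<Sum>j\<in>A. \<E> ?P (\<lambda>C. k (C i) * k (C j)))"
    using finP by (simp add: sum_product \<E>_sum)
  also have "\<dots> = (\<Sum>i\<in>A. \<E> q (\<lambda>u. k u * k u))"
    using finA by (intro sum.cong refl) (simp add: off)
  also have "\<dots> \<le> N * T" using var N by (simp add: N_def)
  finally have sq: "\<E> ?P (\<lambda>C. (\<Sum>i\<in>A. k (C i)) * (\<Sum>i\<in>A. k (C i))) \<le> N * T" .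
  have "\<bar>\<mu> - (\<Sum>i\<in>A. h (C i)) / N\<bar> \<le> (\<Sum>i\<in>A. k (C i)) * (\<Sum>i\<in>A. k (C i)) * (1 / (2 * c * N * N)) + c / 2" for C
  proof -
    have s: "(\<Sum>i\<in>A. k (C i)) = (\<Sum>i\<in>A. h (C i)) - N * \<mu>"
      by (simp add: k_def sum_subtractf N_def)
    define x where "x = (\<Sum>i\<in>A. k (C i)) / N"
    have x: "(\<Sum>i\<in>A. k (C i)) = x * N" using N by (simp add: x_def)
    have "\<mu> - (\<Sum>i\<in>A. h (C i)) / N = - x" using N by (simp add: x_def s field_simps)
    moreover have "\<bar>x\<bar> \<le> x * x / (2 * c) + c / 2"
    proof -
      have "0 \<le> (\<bar>x\<bar> - c) * (\<bar>x\<bar> - c)" by simp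
      then have "2 * c * \<bar>x\<bar> \<le> x * x + c * c" by (simp add: algebra_simps)
      then show ?thesis using c by (simp add: field_simps)
    qed
    moreover have "x * N * (x * N) * (1 / (2 * c * N * N)) = x * x / (2 * c)"
      using N c by (simp add: field_simps)
    ultimately show ?thesis unfolding x by simp
  qed
  then have "\<E> ?P (\<lambda>C. \<bar>\<mu> - (\<Sum>i\<in>A. h (C i)) / N\<bar>) \<le>
     \<E> ?P (\<lambda>C. (\<Sum>i\<in>A. k (C i)) * (\<Sum>i\<in>A. k (C i)) * (1 / (2 * c * N * N)) + c / 2)"
    using finP by (intro \<E>_mono) auto
  also have "\<dots> = \<E> ?P (\<lambda>C. (\<Sum>i\<in>A. k (C i)) * (\<Sum>i\<in>A. k (C i))) * (1 / (2 * c * N * N)) + c / 2"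
    using finP by (simp add: \<E>_add)
  also have "\<dots> \<le> N * T * (1 / (2 * c * N * N)) + c / 2"
    using sq N c by (intro add_right_mono mult_right_mono) auto
  also have "\<dots> = (T / N) / (2 * c) + c / 2" using N by (simp add: field_simps)
  also have "\<dots> = c" using c by (simp flip: cc)
  finally show ?thesis by (simp add: \<mu>_def c_def N_def)
qed

subsection \<open>Density ratios and soft covering\<close>

text \<open>The Radon-Nikodym derivative of \<open>p\<close> against the product of its marginals.
  Where a marginal vanishes, division by zero gives 0, in agreement with
  \<open>pmf p (a, b) = 0\<close> there.\<close>

definition dens :: "('a \<times> 'b) pmf \<Rightarrow> 'a \<Rightarrow> 'b \<Rightarrow> real" where
  "dens p a b = pmf p (a, b) / (pmf (map_pmf fst p) a * pmf (map_pmf snd p) b)"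

lemma dens_nonneg: "0 \<le> dens p a b"
  by (simp add: dens_def)

lemma pmf_eq_dens: "pmf p (a, b) = pmf (map_pmf fst p) a * pmf (map_pmf snd p) b * dens p a b"
proof (cases "(a, b) \<in> set_pmf p")
  case True
  then have "a \<in> set_pmf (map_pmf fst p)" "b \<in> set_pmf (map_pmf snd p)" by force+
  then have "pmf (map_pmf fst p) a \<noteq> 0" "pmf (map_pmf snd p) b \<noteq> 0"
    by (metis set_pmf_iff)+
  then show ?thesis by (simp add: dens_def)
next
  case False
  then have "pmf p (a, b) = 0" by (simp add: set_pmf_iff)
  then show ?thesis by (simp add: dens_def)
qed

text \<open>Change of measure from independent coordinates to the joint law. It turns sums of
  density ratios over independently drawn codewords back into probabilities under
  \<open>p\<close>.\<close>

lemma \<E>_dens: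
  assumes fin: "finite (set_pmf p)"
  shows "\<E> (map_pmf fst p) (\<lambda>a. \<E> (map_pmf snd p) (\<lambda>b. dens p a b * f a b)) = \<E> p (\<lambda>(a, b). f a b)"
proof -
  let ?A = "set_pmf (map_pmf fst p)" and ?B = "set_pmf (map_pmf snd p)"
  have f: "finite ?A" "finite ?B" using fin by auto
  have "\<E> (map_pmf fst p) (\<lambda>a. \<E> (map_pmf snd p) (\<lambda>b. dens p a b * f a b)) =
    (\<Sum>a\<in>?A. pmf (map_pmf fst p) a * (\<Sum>b\<in>?B. pmf (map_pmf snd p) b * (dens p a b * f a b)))"
    using f by (subst (1 2) \<E>_eq_sum) auto
  also have "\<dots> = (\<Sum>a\<in>?A. \<Sum>b\<in>?B. pmf p (a, b) * f a b)"
    by (simp add: pmf_eq_dens[of p] sum_distrib_left mult_ac)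
  also have "\<dots> = (\<Sum>x\<in>?A \<times> ?B. pmf p x * (case x of (a, b) \<Rightarrow> f a b))"
    by (simp add: sum.cartesian_product case_prod_beta)
  also have "\<dots> = \<E> p (\<lambda>(a, b). f a b)"
    using f by (subst integral_measure_pmf[of "?A \<times> ?B"]) (auto intro: rev_image_eqI)
  finally show ?thesis .
qed

text \<open>Test the change of measure on the indicator of \<open>b\<close> and divide by the
  positive mass of \<open>b\<close>. Each term of a covering sum thus has mean 1, the value around
  which soft covering measures the deviation.\<close>

lemma \<E>_dens_fst:
  assumes fin: "finite (set_pmf p)" and b: "b \<in> set_pmf (map_pmf snd p)"
  shows "\<E> (map_pmf fst p) (\<lambda>a. dens p a b) = 1"
proof -
  have "\<E> (map_pmf fst p) (\<lambda>a. \<E> (map_pmf snd p) (\<lambda>b'. dens p a b' * of_bool (b' = b))) =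
      \<E> (map_pmf snd p) (\<lambda>b'. of_bool (b' = b))"
    unfolding \<E>_dens[OF fin, of "\<lambda>_ b'. of_bool (b' = b)"]
    by (simp add: case_prod_unfold)
  moreover have "\<E> (map_pmf snd p) (\<lambda>b'. f b' * of_bool (b' = b)) = pmf (map_pmf snd p) b * f b" for f
    unfolding \<E>_eq_point[of "map_pmf snd p" b f, symmetric] by (rule \<E>_cong) simp
  from this[of "\<lambda>_. 1"] this have "\<E> (map_pmf snd p) (\<lambda>b'. of_bool (b' = b)) = pmf (map_pmf snd p) b"
    "\<And>a. \<E> (map_pmf snd p) (\<lambda>b'. dens p a b' * of_bool (b' = b)) = pmf (map_pmf snd p) b * dens p a b"
    by simp_all
  ultimately have "pmf (map_pmf snd p) b * \<E> (map_pmf fst p) (\<lambda>a. dens p a b) = pmf (map_pmf snd p) b"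
    by simp
  moreover have "pmf (map_pmf snd p) b \<noteq> 0" using b by (metis set_pmf_iff)
  ultimately show ?thesis by simp
qed

text \<open>
  The density ratio is split at the threshold \<open>T\<close>: the bounded part is controlled by its variance,
  the rest by its mean.
\<close>

lemma soft_covering:
  fixes p :: "('a \<times> 'b) pmf"
  assumes fin: "finite (set_pmf p)" and I: "finite I" "A \<subseteq> I" "A \<noteq> {}" and "T > 0"
  shows "\<E> (Pi_pmf I u0 (\<lambda>_. map_pmf fst p))
      (\<lambda>C. \<E> (map_pmf snd p) (\<lambda>v. \<bar>1 - (\<Sum>i\<in>A. dens p (C i) v) / real (card A)\<bar>))
    \<le> sqrt (T / card A) + 2 * measure_pmf.prob p {(a, b). dens p a b > T}"
proof -
  define q r where "q = map_pmf fst p" and "r = map_pmf snd p"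
  note qr = q_def[symmetric] r_def[symmetric]
  let ?P = "Pi_pmf I u0 (\<lambda>_. q)"
  define N where "N = real (card A)"
  have finA: "finite A" using I finite_subset by blast
  have N: "N > 0" using I finA by (auto simp: N_def card_gt_0_iff)
  have finqr: "finite (set_pmf q)" "finite (set_pmf r)" using fin by (auto simp: q_def r_def)
  have finP: "finite (set_pmf ?P)" using finqr I by (intro finite_set_Pi_pmf) auto
  define g where "g u v = dens p u v * of_bool (dens p u v > T)" for u v
  define f where "f u v = dens p u v * of_bool (dens p u v \<le> T)" for u v
  have fg: "dens p u v = f u v + g u v" for u v by (simp add: f_def g_def)
  have f0: "0 \<le> f u v" and g0: "0 \<le> g u v" and fT: "f u v \<le> T" for u v
    using dens_nonneg[of p u v] \<open>T > 0\<close> by (auto simp: f_def g_def)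
  define \<beta> where "\<beta> v = \<E> q (\<lambda>u. g u v)" for v
  have "\<E> ?P (\<lambda>C. \<bar>1 - (\<Sum>i\<in>A. dens p (C i) v) / N\<bar>) \<le> sqrt (T / N) + 2 * \<beta> v" if v: "v \<in> set_pmf r" for v
  proof -
    have one: "\<E> q (\<lambda>u. f u v) + \<beta> v = 1"
      using \<E>_dens_fst[OF fin, unfolded qr, OF v] finqr unfolding fg[abs_def] \<beta>_def by (simp add: \<E>_add)
    have "\<E> q (\<lambda>u. f u v * f u v) \<le> \<E> q (\<lambda>u. T * f u v)"
      using finqr f0 fT by (intro \<E>_mono mult_right_mono) auto
    also have "\<dots> = T * \<E> q (\<lambda>u. f u v)" by simp
    also have "\<dots> \<le> T * 1"
    proof (intro mult_left_mono)
      show "\<E> q (\<lambda>u. f u v) \<le> 1"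
      proof -
        have "0 \<le> \<beta> v" unfolding \<beta>_def by (intro \<E>_nonneg g0)
        then show ?thesis using one by simp
      qed
    qed (use \<open>T > 0\<close> in auto)
    finally have fsq: "\<E> q (\<lambda>u. f u v * f u v) \<le> T" by simp
    have dev: "\<E> ?P (\<lambda>C. \<bar>\<E> q (\<lambda>u. f u v) - (\<Sum>i\<in>A. f (C i) v) / N\<bar>) \<le> sqrt (T / N)"
      unfolding N_def using finqr I \<open>T > 0\<close> fsq by (intro \<E>_empirical_mean_deviation) auto
    have gm: "\<E> ?P (\<lambda>C. (\<Sum>i\<in>A. g (C i) v) / N) = \<beta> v"
    proof -
      have "\<E> ?P (\<lambda>C. (\<Sum>i\<in>A. g (C i) v) / N) = (\<Sum>i\<in>A. \<E> ?P (\<lambda>C. g (C i) v)) / N"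
        using finP by (simp add: \<E>_sum)
      also have "(\<Sum>i\<in>A. \<E> ?P (\<lambda>C. g (C i) v)) = (\<Sum>i\<in>A. \<beta> v)"
        unfolding \<beta>_def using I 
        by (intro sum.cong refl \<E>_Pi_component[where k = "\<lambda>u. g u v" and p = "\<lambda>_. q"]) auto
      finally show ?thesis using N by (simp add: N_def)
    qed
    \<comment> \<open>\<open>\<beta> v\<close> is paid twice, which gives the factor 2 in the bound:
      once because the bounded part has mean \<open>1 - \<beta> v\<close> instead of 1, once as the
      mean of the discarded part over the codebook.\<close>
    have "\<E> ?P (\<lambda>C. \<bar>1 - (\<Sum>i\<in>A. dens p (C i) v) / N\<bar>) \<le>
       \<E> ?P (\<lambda>C. \<bar>\<E> q (\<lambda>u. f u v) - (\<Sum>i\<in>A. f (C i) v) / N\<bar> + \<beta> v + (\<Sum>i\<in>A. g (C i) v) / N)"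
    proof (rule \<E>_mono[OF finP])
      fix C
      have "0 \<le> \<beta> v" unfolding \<beta>_def by (intro \<E>_nonneg g0)
      moreover have "0 \<le> (\<Sum>i\<in>A. g (C i) v) / N" using g0 N by (simp add: sum_nonneg)
      moreover have "1 - (\<Sum>i\<in>A. dens p (C i) v) / N =
          \<E> q (\<lambda>u. f u v) - (\<Sum>i\<in>A. f (C i) v) / N + \<beta> v - (\<Sum>i\<in>A. g (C i) v) / N"
        unfolding fg sum.distrib add_divide_distrib using one by linarith
      ultimately show "\<bar>1 - (\<Sum>i\<in>A. dens p (C i) v) / N\<bar> \<le>
          \<bar>\<E> q (\<lambda>u. f u v) - (\<Sum>i\<in>A. f (C i) v) / N\<bar> + \<beta> v + (\<Sum>i\<in>A. g (C i) v) / N"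
        by linarith
    qed
    also have "\<dots> = \<E> ?P (\<lambda>C. \<bar>\<E> q (\<lambda>u. f u v) - (\<Sum>i\<in>A. f (C i) v) / N\<bar>) + \<beta> v
          + \<E> ?P (\<lambda>C. (\<Sum>i\<in>A. g (C i) v) / N)"
      using finP by (simp only: \<E>_add \<E>_const)
    finally show ?thesis using dev gm by linarith
  qed
  then have "\<E> r (\<lambda>v. \<E> ?P (\<lambda>C. \<bar>1 - (\<Sum>i\<in>A. dens p (C i) v) / N\<bar>)) \<le> \<E> r (\<lambda>v. sqrt (T / N) + 2 * \<beta> v)"
    using finqr by (intro \<E>_mono) auto
  also have "\<dots> = sqrt (T / N) + 2 * \<E> r \<beta>" using finqr by (simp add: \<E>_add)
  also have "\<E> r \<beta> = \<E> q (\<lambda>u. \<E> r (\<lambda>v. g u v))"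
    unfolding \<beta>_def using finqr by (intro \<E>_swap) auto
  also have "\<dots> = \<E> p (\<lambda>(u, v). of_bool (dens p u v > T))"
    unfolding g_def by (rule \<E>_dens[OF fin, unfolded qr])
  also have "\<dots> = measure_pmf.prob p {(a, b). dens p a b > T}"
    using \<E>_of_bool[of p "\<lambda>(u, v). dens p u v > T"] by (simp add: case_prod_unfold)
  finally show ?thesis
    using \<E>_swap[OF finP finqr(2)] unfolding qr by (simp add: N_def)
qed

subsection \<open>Weighted choice and couplings\<close>

definition weighted_pmf :: "'a set \<Rightarrow> ('a \<Rightarrow> real) \<Rightarrow> 'a pmf" where
  "weighted_pmf A w = embed_pmf (\<lambda>x. if x \<in> A then w x / sum w A else 0)"

lemma pmf_weighted:
  assumes "finite A" "\<And>x. x \<in> A \<Longrightarrow> 0 \<le> w x" "0 < sum w A"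
  shows "pmf (weighted_pmf A w) x = (if x \<in> A then w x / sum w A else 0)"
  unfolding weighted_pmf_def
proof (rule pmf_embed_pmf)
  let ?f = "\<lambda>x. if x \<in> A then w x / sum w A else 0"
  show nn: "0 \<le> ?f x" for x using assms by simp
  have "(\<integral>\<^sup>+x. ennreal (?f x) \<partial>count_space UNIV) = (\<Sum>x\<in>A. ennreal (?f x))"
    using assms nn by (intro nn_integral_count_space') auto
  also have "\<dots> = ennreal (\<Sum>x\<in>A. ?f x)" using nn by (rule sum_ennreal)
  also have "(\<Sum>x\<in>A. ?f x) = 1" using assms by (simp flip: sum_divide_distrib)
  finally show "(\<integral>\<^sup>+x. ennreal (?f x) \<partial>count_space UNIV) = 1" by simp
qed

lemma set_weighted_pmf:
  assumes "finite A" "\<And>x. x \<in> A \<Longrightarrow> 0 \<le> w x" "0 < sum w A"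
  shows "set_pmf (weighted_pmf A w) \<subseteq> A"
  using pmf_weighted[OF assms] by (auto simp: set_pmf_iff split: if_splits)

text \<open>
  The hypothesis bounds the total variation distance of \<open>p\<close> and \<open>q\<close>, in its dual form.
\<close>

lemma coupling_kernel:
  fixes p q :: "'a pmf"
  assumes fin: "finite (set_pmf p)" "finite (set_pmf q)"
    and \<tau>: "\<And>\<sigma>. (\<And>x. \<bar>\<sigma> x\<bar> \<le> 1) \<Longrightarrow> \<E> p \<sigma> - \<E> q \<sigma> \<le> \<tau>"
  obtains \<kappa> where "bind_pmf p \<kappa> = q" "\<And>x. set_pmf (\<kappa> x) \<subseteq> insert x (set_pmf q)"
    "\<E> p (\<lambda>x. measure_pmf.prob (\<kappa> x) {y. y \<noteq> x}) \<le> \<tau>"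
proof (cases "p = q")
  case True
  have "0 \<le> \<tau>" using \<tau>[of "\<lambda>_. 0"] by simp
  then show ?thesis using True
    by (intro that[of return_pmf]) (auto simp: bind_return_pmf' indicator_def)
next
  case False
  define A where "A = set_pmf p \<union> set_pmf q"
  have finA: "finite A" using fin by (simp add: A_def)
  \<comment> \<open>\<open>w\<close> and \<open>v\<close> are the two signed excesses. They have
    equal total mass, positive because \<open>p \<noteq> q\<close>, so that \<open>w\<close> can be
    normalised; this is why the case of equality is separate.\<close>
  define w where "w x = max 0 (pmf q x - pmf p x)" for x
  define v where "v x = max 0 (pmf p x - pmf q x)" for x
  have sums: "sum (pmf p) A = 1" "sum (pmf q) A = 1"
    using finA by (auto simp: A_def intro!: sum_pmf_eq_1)
  have "sum v A - sum w A = sum (pmf p) A - sum (pmf q) A"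
    unfolding sum_subtractf[symmetric] by (intro sum.cong) (auto simp: v_def w_def)
  then have vw: "sum v A = sum w A" by (simp add: sums)
  have "sum w A > 0"
  proof (rule ccontr)
    assume "\<not> ?thesis"
    then have "sum w A = 0" "sum v A = 0" using vw sum_nonneg[of A w] by (auto simp: w_def)
    then have "\<And>x. x \<in> A \<Longrightarrow> w x = 0 \<and> v x = 0"
      using finA by (auto simp: sum_nonneg_eq_0_iff w_def v_def)
    then have "pmf p x = pmf q x" if "x \<in> A" for x
      using that by (fastforce simp: w_def v_def max_def split: if_splits)
    moreover have "pmf p x = pmf q x" if "x \<notin> A" for x
      using that by (simp add: A_def set_pmf_iff)
    ultimately have "p = q" by (metis pmf_eqI)
    with False show False by simp
  qed
  define t where "t = sum w A"
  have t: "t > 0" using \<open>sum w A > 0\<close> by (simp add: t_def)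
  define r where "r = weighted_pmf A w"
  have w0: "0 \<le> w x" for x by (simp add: w_def)
  have wA: "w x = 0" if "x \<notin> A" for x using that by (simp add: A_def w_def set_pmf_iff)
  have pmfr: "pmf r x = w x / t" for x
    unfolding r_def t_def using finA w0 wA \<open>sum w A > 0\<close> by (subst pmf_weighted) auto
  have setr: "set_pmf r \<subseteq> set_pmf q"
    using t by (auto simp: set_pmf_iff pmfr w_def)
  \<comment> \<open>The optimal coupling read as a kernel: keep \<open>x\<close> with probability
    \<open>a x\<close>, so that \<open>min (pmf p x) (pmf q x)\<close> stays in place, and otherwise
    resample from the normalised excess of \<open>q\<close>.\<close>
  define a where "a x = (if pmf p x > pmf q x then pmf q x / pmf p x else 1)" for x
  have a: "0 \<le> a x" "a x \<le> 1" for x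
    using pmf_nonneg[of q x] by (auto simp: a_def divide_le_eq)
  have pa: "pmf p x * a x = min (pmf p x) (pmf q x)" for x
    using pmf_nonneg[of q x] by (auto simp: a_def)
  define \<kappa> where "\<kappa> x = bind_pmf (bernoulli_pmf (a x)) (\<lambda>b. if b then return_pmf x else r)" for x
  have pmf\<kappa>: "pmf (\<kappa> x) y = a x * of_bool (x = y) + (1 - a x) * pmf r y" for x y
    unfolding \<kappa>_def using a[of x] by (simp add: pmf_bind indicator_def)
  have lost: "\<E> p (\<lambda>x. 1 - a x) = t"
  proof -
    have "\<E> p (\<lambda>x. 1 - a x) = (\<Sum>x\<in>A. pmf p x * (1 - a x))"
      using finA by (subst integral_measure_pmf[of A]) (auto simp: A_def)
    also have "\<dots> = sum v A"
      by (intro sum.cong refl) (simp add: right_diff_distrib pa v_def)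
    finally show ?thesis by (simp add: vw t_def)
  qed
  show ?thesis
  proof (rule that[of \<kappa>])
    show "bind_pmf p \<kappa> = q"
    proof (rule pmf_eqI)
      fix y
      have "pmf (bind_pmf p \<kappa>) y = \<E> p (\<lambda>x. (if x = y then a x else 0) + (1 - a x) * pmf r y)"
        unfolding pmf_bind pmf\<kappa> by (rule \<E>_cong) simp
      also have "\<dots> = pmf p y * a y + t * pmf r y"
        using fin lost by (simp add: \<E>_add \<E>_eq_point)
      also have "\<dots> = pmf q y" using t by (simp add: pa pmfr w_def)
      finally show "pmf (bind_pmf p \<kappa>) y = pmf q y" .
    qed
    show "set_pmf (\<kappa> x) \<subseteq> insert x (set_pmf q)" for x
      using setr by (auto simp: \<kappa>_def split: if_splits)
    have "measure_pmf.prob (\<kappa> x) {y. y \<noteq> x} \<le> 1 - a x" for x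
    proof -
      have "measure_pmf.prob (\<kappa> x) {y. y \<noteq> x} = 1 - measure_pmf.prob (\<kappa> x) {x}"
        using measure_pmf.prob_compl[of "{x}" "\<kappa> x"] by (simp add: Compl_eq_Diff_UNIV[symmetric] Collect_neg_eq)
      also have "\<dots> = 1 - pmf (\<kappa> x) x" by (simp add: measure_pmf_single)
      also have "\<dots> \<le> 1 - a x" using a[of x] by (simp add: pmf\<kappa>)
      finally show ?thesis .
    qed
    then have "\<E> p (\<lambda>x. measure_pmf.prob (\<kappa> x) {y. y \<noteq> x}) \<le> t"
      using \<E>_mono[OF fin(1), of "\<lambda>x. measure_pmf.prob (\<kappa> x) {y. y \<noteq> x}" "\<lambda>x. 1 - a x"]
      unfolding lost by simp
    moreover have "t \<le> \<tau>"
    proof -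
      \<comment> \<open>The indicator of the set where \<open>p\<close> exceeds \<open>q\<close>
        attains the whole excess mass \<open>t\<close>.\<close>
      let ?\<sigma> = "\<lambda>x. of_bool (pmf p x > pmf q x)"
      have "\<E> p ?\<sigma> = (\<Sum>x\<in>A. pmf p x * ?\<sigma> x)" "\<E> q ?\<sigma> = (\<Sum>x\<in>A. pmf q x * ?\<sigma> x)"
        using finA by (auto simp: A_def integral_measure_pmf[of A])
      then have "\<E> p ?\<sigma> - \<E> q ?\<sigma> = (\<Sum>x\<in>A. pmf p x * ?\<sigma> x - pmf q x * ?\<sigma> x)"
        by (simp only: sum_subtractf)
      also have "\<dots> = sum v A"
        by (intro sum.cong) (auto simp: v_def)
      finally have "\<E> p ?\<sigma> - \<E> q ?\<sigma> = sum v A" .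
      then show ?thesis using \<tau>[of ?\<sigma>] by (simp add: vw t_def)
    qed
    ultimately show "\<E> p (\<lambda>x. measure_pmf.prob (\<kappa> x) {y. y \<noteq> x}) \<le> \<tau>" by simp
  qed
qed

section \<open>Averages over finite index sets\<close>

lemma \<E>_pmf_of_set:
  assumes "finite A" "A \<noteq> {}"
  shows "\<E> (pmf_of_set A) f = (\<Sum>x\<in>A. f x) / real (card A)"
  using assms by (simp add: \<E>_eq_sum sum_divide_distrib)

lemma abs_sum_average_le:
  fixes f h :: "'i \<Rightarrow> real"
  assumes "\<And>i. i \<in> A \<Longrightarrow> \<bar>f i\<bar> \<le> h i"
  shows "\<bar>(\<Sum>i\<in>A. f i) / real n\<bar> \<le> (\<Sum>i\<in>A. h i) / real n"
proof -
  have "\<bar>\<Sum>i\<in>A. f i\<bar> \<le> (\<Sum>i\<in>A. h i)"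
    using assms by (intro order.trans[OF sum_abs] sum_mono) auto
  then show ?thesis by (simp add: divide_right_mono)
qed

lemma average_le_const:
  assumes "finite A" "A \<noteq> {}" "\<And>i. i \<in> A \<Longrightarrow> f i \<le> c"
  shows "(\<Sum>i\<in>A. f i) / real (card A) \<le> (c::real)"
proof -
  have "real (card A) > 0" using assms by (simp add: card_gt_0_iff)
  moreover have "(\<Sum>i\<in>A. f i) \<le> real (card A) * c"
    using assms sum_bounded_above[of A f c] by simp
  ultimately show ?thesis by (simp add: divide_le_eq mult.commute)
qed

subsection \<open>One-shot laws\<close>

text \<open>
  The source letter \<open>a\<close> is the pair of side information \<open>e a\<close> and state, and \<open>K u a\<close> is the law of
  channel output and reconstruction, with channel input and feedback already summed out.
\<close>

locale one_shot =
  fixes P :: "'a pmf" and e :: "'a \<Rightarrow> 'e" and PU :: "'e \<Rightarrow> 'u pmf"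
    and K :: "'u \<Rightarrow> 'a \<Rightarrow> ('y \<times> 't) pmf"
  assumes finP: "finite (set_pmf P)"
    and finPU: "\<And>x. finite (set_pmf (PU x))"
    and finK: "\<And>u a. finite (set_pmf (K u a))"
begin

definition J :: "('u \<times> 'a \<times> 'y \<times> 't) pmf" where
  "J = do {a \<leftarrow> P; u \<leftarrow> PU (e a); (y, t) \<leftarrow> K u a; return_pmf (u, a, y, t)}"

definition "qU = map_pmf fst J"
definition "pE = map_pmf (\<lambda>(u, a, y, t). (u, e a)) J"
definition "pY = map_pmf (\<lambda>(u, a, y, t). (u, y)) J"
definition "pT = map_pmf (\<lambda>(u, a, y, t). (u, t)) J"
definition "qE = map_pmf e P"
definition "qY = map_pmf snd pY"
definition "qT = map_pmf snd pT"

lemma finJ: "finite (set_pmf J)"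
  using finP finPU finK by (auto simp: J_def)

lemma fin_marginals: "finite (set_pmf qU)" "finite (set_pmf pE)" "finite (set_pmf pY)"
  "finite (set_pmf pT)" "finite (set_pmf qE)" "finite (set_pmf qY)" "finite (set_pmf qT)"
  using finJ finP by (auto simp: qU_def pE_def pY_def pT_def qE_def qY_def qT_def)

lemma fst_marginals: "map_pmf fst pE = qU" "map_pmf fst pY = qU" "map_pmf fst pT = qU"
  by (auto simp: qU_def pE_def pY_def pT_def map_pmf_comp case_prod_unfold)

lemma pE_eq: "pE = bind_pmf qE (\<lambda>x. map_pmf (\<lambda>u. (u, x)) (PU x))"
  unfolding pE_def J_def qE_def
  by (simp add: map_bind_pmf bind_map_pmf case_prod_unfold map_pmf_def bind_assoc_pmf
      bind_return_pmf)

lemma snd_pE: "map_pmf snd pE = qE"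
  unfolding pE_eq by (simp add: map_bind_pmf map_pmf_comp bind_return_pmf')

lemma \<E>_J: "\<E> J f = \<E> P (\<lambda>a. \<E> (PU (e a)) (\<lambda>u. \<E> (K u a) (\<lambda>(y, t). f (u, a, y, t))))"
  unfolding J_def using finP finPU finK by (simp add: \<E>_bind case_prod_unfold)

lemma pmf_pE: "pmf pE (u, x) = pmf qE x * pmf (PU x) u"
proof -
  have "pmf (map_pmf (\<lambda>u. (u, x')) (PU x')) (u, x) = (if x' = x then pmf (PU x) u else 0)" for x'
  proof (cases "x' = x")
    case True
    then show ?thesis using pmf_map_inj'[of "\<lambda>u. (u, x)" "PU x" u] by (simp add: inj_on_def)
  next
    case False
    then show ?thesis by (auto simp: pmf_eq_0_set_pmf)
  qed
  then show ?thesis unfolding pE_eq pmf_bind by (simp add: \<E>_eq_point)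
qed

lemma dens_pE: "x \<in> set_pmf qE \<Longrightarrow> pmf qU u * dens pE u x = pmf (PU x) u"
  using pmf_eq_dens[of pE u x] pmf_pE[of u x]
  by (simp add: fst_marginals snd_pE set_pmf_iff)

lemma set_PU_subset: "x \<in> set_pmf qE \<Longrightarrow> set_pmf (PU x) \<subseteq> set_pmf qU"
  unfolding fst_marginals(1)[symmetric] pE_eq by force

text \<open>A codeword drawn from \<open>qU\<close> and reweighted by its likelihood follows the
  conditional law given \<open>x\<close>; the likelihood encoder imitates this reweighting inside a
  finite bin.\<close>

lemma \<E>_dens_pE:
  assumes "x \<in> set_pmf qE"
  shows "\<E> qU (\<lambda>u. dens pE u x * G u) = \<E> (PU x) G"
proof -
  have "\<E> qU (\<lambda>u. dens pE u x * G u) = (\<Sum>u\<in>set_pmf qU. pmf (PU x) u * G u)"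
    using fin_marginals by (simp add: \<E>_eq_sum dens_pE[OF assms, symmetric] mult_ac)
  also have "\<dots> = \<E> (PU x) G"
    using fin_marginals set_PU_subset[OF assms] by (subst integral_measure_pmf[of "set_pmf qU"]) auto
  finally show ?thesis .
qed

text \<open>The conditional expectation given \<open>U = u\<close>, for \<open>u\<close> in the support of \<open>qU\<close>.\<close>

definition cE :: "'u \<Rightarrow> ('a \<Rightarrow> 'y \<Rightarrow> 't \<Rightarrow> real) \<Rightarrow> real" where
  "cE u \<psi> = \<E> P (\<lambda>a. dens pE u (e a) * \<E> (K u a) (\<lambda>(y, t). \<psi> a y t))"

lemma \<E>_cE: "\<E> qU (\<lambda>u. cE u (\<psi> u)) = \<E> J (\<lambda>(u, a, y, t). \<psi> u a y t)"
proof -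
  have "\<E> qU (\<lambda>u. cE u (\<psi> u)) =
      \<E> P (\<lambda>a. \<E> qU (\<lambda>u. dens pE u (e a) * \<E> (K u a) (\<lambda>(y, t). \<psi> u a y t)))"
    unfolding cE_def by (rule \<E>_swap) (use finP fin_marginals in auto)
  also have "\<dots> = \<E> P (\<lambda>a. \<E> (PU (e a)) (\<lambda>u. \<E> (K u a) (\<lambda>(y, t). \<psi> u a y t)))"
    by (intro \<E>_cong \<E>_dens_pE) (auto simp: qE_def)
  finally show ?thesis by (simp add: \<E>_J)
qed

text \<open>Both sides are versions of one conditional expectation given U, so they agree at each
  \<open>u\<close> of positive mass: multiply by the indicator of \<open>u\<close>, integrate
  against \<open>qU\<close>, and cancel. Decoding and covering then involve a pair marginal
  only.\<close>

lemma cE_eq_dens: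
  assumes u: "u \<in> set_pmf qU" and p: "p = map_pmf (\<lambda>(u, a, y, t). (u, f a y t)) J"
  shows "cE u (\<lambda>a y t. h (f a y t)) = \<E> (map_pmf snd p) (\<lambda>b. dens p u b * h b)"
proof -
  have fp: "map_pmf fst p = qU"
    by (simp add: p qU_def map_pmf_comp case_prod_unfold)
  have finp: "finite (set_pmf p)" using finJ by (simp add: p)
  define c where "c = cE u (\<lambda>a y t. h (f a y t))"
  define c' where "c' = \<E> (map_pmf snd p) (\<lambda>b. dens p u b * h b)"
  have "pmf qU u * c = \<E> qU (\<lambda>u'. if u' = u then c else 0)"
    by (simp add: \<E>_eq_point)
  also have "\<dots> = \<E> qU (\<lambda>u'. cE u' (\<lambda>a y t. of_bool (u' = u) * h (f a y t)))"
    by (rule \<E>_cong) (auto simp: c_def cE_def case_prod_unfold)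
  also have "\<dots> = \<E> p (\<lambda>(u', b). of_bool (u' = u) * h b)"
    unfolding \<E>_cE by (simp add: p case_prod_unfold)
  also have "\<dots> = \<E> qU (\<lambda>u'. \<E> (map_pmf snd p) (\<lambda>b. dens p u' b * (of_bool (u' = u) * h b)))"
    unfolding \<E>_dens[OF finp, symmetric] fp ..
  also have "\<dots> = \<E> qU (\<lambda>u'. if u' = u then c' else 0)"
    unfolding c'_def by (rule \<E>_cong) (simp del: integral_map_pmf)
  also have "\<dots> = pmf qU u * c'" by (simp add: \<E>_eq_point)
  finally show ?thesis using u by (simp add: c_def c'_def set_pmf_iff)
qed

lemma cE_Y: "u \<in> set_pmf qU \<Longrightarrow> cE u (\<lambda>a y t. h y) = \<E> qY (\<lambda>y. dens pY u y * h y)"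
  unfolding qY_def by (rule cE_eq_dens[where f = "\<lambda>a y t. y"]) (auto simp: pY_def)

lemma cE_T: "u \<in> set_pmf qU \<Longrightarrow> cE u (\<lambda>a y t. h t) = \<E> qT (\<lambda>y. dens pT u y * h y)"
  unfolding qT_def by (rule cE_eq_dens[where f = "\<lambda>a y t. t"]) (auto simp: pT_def)

end

subsection \<open>Random codebooks with a likelihood encoder\<close>

locale random_code = one_shot P e PU K
  for P :: "'a pmf" and e :: "'a \<Rightarrow> 'e" and PU :: "'e \<Rightarrow> 'u pmf"
    and K :: "'u \<Rightarrow> 'a \<Rightarrow> ('y \<times> 't) pmf" +
  fixes M :: "'m set" and L :: "'l set" and G :: "'g set" and u0 :: 'u
  assumes finM: "finite M" "M \<noteq> {}" and finL: "finite L" "L \<noteq> {}" and finG: "finite G" "G \<noteq> {}"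
begin

lemma cards: "real (card M) > 0" "real (card L) > 0" "real (card G) > 0"
  using finM finL finG by (auto simp: card_gt_0_iff)

definition "I = M \<times> L \<times> G"

lemma finI: "finite I" "I \<noteq> {}"
  using finM finL finG by (auto simp: I_def)

definition codebook :: "('m \<times> 'l \<times> 'g \<Rightarrow> 'u) pmf" where
  "codebook = Pi_pmf I u0 (\<lambda>_. qU)"

lemma fin_codebook: "finite (set_pmf codebook)"
  unfolding codebook_def using finI fin_marginals by (intro finite_set_Pi_pmf) auto

lemma set_codebook: "C \<in> set_pmf codebook \<Longrightarrow> i \<in> I \<Longrightarrow> C i \<in> set_pmf qU"
  unfolding codebook_def using finI
  by (simp add: set_Pi_pmf PiE_dflt_def del: split_paired_All)

text \<open>If all weights of the bin vanish there is nothing to normalise; any law on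
  \<open>L\<close> would do as the fallback, since the products in \<open>\<E>_lik\<close> are then
  zero.\<close>

definition lik :: "('m \<times> 'l \<times> 'g \<Rightarrow> 'u) \<Rightarrow> 'm \<Rightarrow> 'g \<Rightarrow> 'e \<Rightarrow> 'l pmf" where
  "lik C m g x = (if 0 < (\<Sum>l\<in>L. dens pE (C (m, l, g)) x)
     then weighted_pmf L (\<lambda>l. dens pE (C (m, l, g)) x) else pmf_of_set L)"

lemma set_lik: "set_pmf (lik C m g x) \<subseteq> L"
  unfolding lik_def using finL set_weighted_pmf[of L "\<lambda>l. dens pE (C (m, l, g)) x"]
  by (auto simp: dens_nonneg split: if_splits)

lemma fin_lik: "finite (set_pmf (lik C m g x))"
  by (rule finite_subset[OF set_lik finL(1)])

text \<open>The total weight cancels against the normalisation of the encoder. With zero total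
  weight every single weight is zero, so the identity holds for all codebooks and all
  \<open>x\<close>.\<close>

lemma \<E>_lik:
  "(\<Sum>l\<in>L. dens pE (C (m, l, g)) x * F l) = (\<Sum>l\<in>L. dens pE (C (m, l, g)) x) * \<E> (lik C m g x) F"
proof (cases "0 < (\<Sum>l\<in>L. dens pE (C (m, l, g)) x)")
  case True
  let ?w = "\<lambda>l. dens pE (C (m, l, g)) x"
  have "\<E> (lik C m g x) F = (\<Sum>l\<in>L. pmf (lik C m g x) l * F l)"
    using finL subsetD[OF set_lik[of C m g x]] by (subst integral_measure_pmf[of L]) auto
  also have "\<dots> = (\<Sum>l\<in>L. ?w l / sum ?w L * F l)"
    using True finL by (intro sum.cong refl) (simp add: lik_def pmf_weighted dens_nonneg)
  also have "\<dots> = (\<Sum>l\<in>L. ?w l * F l) / sum ?w L"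
    by (simp add: sum_divide_distrib)
  finally show ?thesis using True by simp
next
  case False
  then have "(\<Sum>l\<in>L. dens pE (C (m, l, g)) x) = 0"
    using sum_nonneg[of L "\<lambda>l. dens pE (C (m, l, g)) x"] by (simp add: dens_nonneg)
  moreover from this have "\<And>l. l \<in> L \<Longrightarrow> dens pE (C (m, l, g)) x = 0"
    using finL by (simp add: sum_nonneg_eq_0_iff dens_nonneg)
  ultimately show ?thesis by simp
qed

definition law :: "('m \<times> 'l \<times> 'g \<Rightarrow> 'u) \<Rightarrow> ('m \<times> 'l \<times> 'g \<times> 'a \<times> 'y \<times> 't) pmf" where
  "law C = do {m \<leftarrow> pmf_of_set M; g \<leftarrow> pmf_of_set G; a \<leftarrow> P; l \<leftarrow> lik C m g (e a);
     (y, t) \<leftarrow> K (C (m, l, g)) a; return_pmf (m, l, g, a, y, t)}"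

text \<open>A functional instead of a pmf: \<open>cE\<close> has total mass one only at codewords in
  the support of \<open>qU\<close>. Being linear in the values of \<open>cE\<close>, it can be
  averaged over codebooks term by term.\<close>

definition ideal :: "('m \<times> 'l \<times> 'g \<Rightarrow> 'u) \<Rightarrow> ('m \<Rightarrow> 'l \<Rightarrow> 'g \<Rightarrow> 'a \<Rightarrow> 'y \<Rightarrow> 't \<Rightarrow> real) \<Rightarrow> real" where
  "ideal C \<phi> = (\<Sum>m\<in>M. (\<Sum>g\<in>G. (\<Sum>l\<in>L. cE (C (m, l, g)) (\<phi> m l g)) / card L) / card G) / card M"

text \<open>
  The next two are the soft covering errors: for \<open>S_e\<close>, at fixed message and common randomness,
  and for the reconstruction, over the whole codebook.
\<close>

definition devE :: "('m \<times> 'l \<times> 'g \<Rightarrow> 'u) \<Rightarrow> real" where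
  "devE C = (\<Sum>m\<in>M. (\<Sum>g\<in>G. \<E> qE (\<lambda>x. \<bar>1 - (\<Sum>l\<in>L. dens pE (C (m, l, g)) x) / card L\<bar>)) / card G) / card M"

definition devT :: "('m \<times> 'l \<times> 'g \<Rightarrow> 'u) \<Rightarrow> real" where
  "devT C = \<E> qT (\<lambda>x. \<bar>1 - (\<Sum>i\<in>I. dens pT (C i) x) / card I\<bar>)"

lemma fin_law: "finite (set_pmf (law C))"
  using finP finK fin_lik finM finG by (auto simp: law_def)

lemma \<E>_law: "\<E> (law C) f = (\<Sum>m\<in>M. (\<Sum>g\<in>G. \<E> P (\<lambda>a. \<E> (lik C m g (e a)) (\<lambda>l.
     \<E> (K (C (m, l, g)) a) (\<lambda>(y, t). f (m, l, g, a, y, t))))) / card G) / card M"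
  unfolding law_def using finP finK fin_lik finM finG
  by (simp add: \<E>_bind case_prod_unfold \<E>_pmf_of_set mult.commute sum_divide_distrib[symmetric])

text \<open>
  By the choice of the likelihood encoder, the ideal law is the true one reweighted by the average of
  the density ratios over the bin.
\<close>

lemma law_close_to_ideal:
  assumes B: "\<And>m l g a y t. \<bar>\<phi> m l g a y t\<bar> \<le> B"
  shows "\<bar>\<E> (law C) (\<lambda>(m, l, g, a, y, t). \<phi> m l g a y t) - ideal C \<phi>\<bar> \<le> B * devE C"
proof -
  have "0 \<le> B" using B by (meson abs_ge_zero order_trans)
  let ?F = "\<lambda>m g a l. \<E> (K (C (m, l, g)) a) (\<lambda>(y, t). \<phi> m l g a y t)"
  let ?s = "\<lambda>m g x. (\<Sum>l\<in>L. dens pE (C (m, l, g)) x) / card L"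
  have bound: "\<bar>\<E> P (\<lambda>a. \<E> (lik C m g (e a)) (?F m g a)) - (\<Sum>l\<in>L. cE (C (m, l, g)) (\<phi> m l g)) / card L\<bar>
     \<le> B * \<E> qE (\<lambda>x. \<bar>1 - ?s m g x\<bar>)" for m g
  proof -
    have "(\<Sum>l\<in>L. cE (C (m, l, g)) (\<phi> m l g)) / card L =
        \<E> P (\<lambda>a. (\<Sum>l\<in>L. dens pE (C (m, l, g)) (e a) * ?F m g a l) / card L)"
      unfolding cE_def using finP by (simp add: \<E>_sum)
    also have "\<dots> = \<E> P (\<lambda>a. ?s m g (e a) * \<E> (lik C m g (e a)) (?F m g a))"
      unfolding \<E>_lik[of C m g] by simp
    finally have "\<bar>\<E> P (\<lambda>a. \<E> (lik C m g (e a)) (?F m g a)) - (\<Sum>l\<in>L. cE (C (m, l, g)) (\<phi> m l g)) / card L\<bar>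
      = \<bar>\<E> P (\<lambda>a. (1 - ?s m g (e a)) * \<E> (lik C m g (e a)) (?F m g a))\<bar>"
      using finP by (simp only: \<E>_diff left_diff_distrib mult_1_left)
    also have "\<dots> \<le> \<E> P (\<lambda>a. \<bar>(1 - ?s m g (e a)) * \<E> (lik C m g (e a)) (?F m g a)\<bar>)"
      by (rule integral_abs_bound)
    also have "\<dots> \<le> \<E> P (\<lambda>a. B * \<bar>1 - ?s m g (e a)\<bar>)"
    proof (rule \<E>_mono[OF finP])
      fix a
      have "\<bar>?F m g a l\<bar> \<le> B" for l
        using B finK by (intro order.trans[OF integral_abs_bound] \<E>_le_const) auto
      then have "\<bar>\<E> (lik C m g (e a)) (?F m g a)\<bar> \<le> B"
        by (intro order.trans[OF integral_abs_bound \<E>_le_const[OF fin_lik]])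
      then show "\<bar>(1 - ?s m g (e a)) * \<E> (lik C m g (e a)) (?F m g a)\<bar> \<le> B * \<bar>1 - ?s m g (e a)\<bar>"
        unfolding abs_mult by (subst mult.commute) (rule mult_right_mono, auto)
    qed
    also have "\<dots> = B * \<E> qE (\<lambda>x. \<bar>1 - ?s m g x\<bar>)" by (simp add: qE_def)
    finally show ?thesis .
  qed
  have "\<E> (law C) (\<lambda>(m, l, g, a, y, t). \<phi> m l g a y t) - ideal C \<phi> =
    (\<Sum>m\<in>M. (\<Sum>g\<in>G. \<E> P (\<lambda>a. \<E> (lik C m g (e a)) (?F m g a)) - (\<Sum>l\<in>L. cE (C (m, l, g)) (\<phi> m l g)) / card L) / card G) / card M"
    unfolding \<E>_law ideal_def by (simp add: sum_subtractf diff_divide_distrib)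
  also have "\<bar>\<dots>\<bar> \<le> (\<Sum>m\<in>M. (\<Sum>g\<in>G. B * \<E> qE (\<lambda>x. \<bar>1 - ?s m g x\<bar>)) / card G) / card M"
    by (intro abs_sum_average_le bound)
  also have "\<dots> = B * devE C"
    by (simp add: devE_def sum_distrib_left)
  finally show ?thesis .
qed

lemma ideal_T:
  assumes "C \<in> set_pmf codebook"
  shows "ideal C (\<lambda>m l g a y t. \<sigma> t) = \<E> qT (\<lambda>t. (\<Sum>i\<in>I. dens pT (C i) t) / card I * \<sigma> t)"
proof -
  have "ideal C (\<lambda>m l g a y t. \<sigma> t) = (\<Sum>m\<in>M. \<Sum>g\<in>G. \<Sum>l\<in>L. cE (C (m, l, g)) (\<lambda>a y t. \<sigma> t)) / card I"
    by (simp add: ideal_def I_def card_cartesian_product sum_divide_distrib divide_simps mult_ac)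
  also have "(\<Sum>m\<in>M. \<Sum>g\<in>G. \<Sum>l\<in>L. cE (C (m, l, g)) (\<lambda>a y t. \<sigma> t)) =
      (\<Sum>m\<in>M. \<Sum>l\<in>L. \<Sum>g\<in>G. cE (C (m, l, g)) (\<lambda>a y t. \<sigma> t))"
    by (intro sum.cong refl sum.swap)
  also have "\<dots> = (\<Sum>i\<in>I. cE (C i) (\<lambda>a y t. \<sigma> t))"
    by (simp add: I_def sum.cartesian_product case_prod_unfold)
  also have "\<dots> = (\<Sum>i\<in>I. \<E> qT (\<lambda>t. dens pT (C i) t * \<sigma> t))"
    using set_codebook[OF assms] by (intro sum.cong refl cE_T) auto
  also have "\<dots> / card I = \<E> qT (\<lambda>t. (\<Sum>i\<in>I. dens pT (C i) t) / card I * \<sigma> t)"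
    using fin_marginals by (simp add: \<E>_sum[symmetric] sum_distrib_right)
  finally show ?thesis .
qed

lemma law_T_close:
  assumes C: "C \<in> set_pmf codebook" and \<sigma>: "\<And>t. \<bar>\<sigma> t\<bar> \<le> 1"
  shows "\<E> (map_pmf (\<lambda>(m, l, g, a, y, t). t) (law C)) \<sigma> - \<E> qT \<sigma> \<le> devE C + devT C"
proof -
  have "\<E> (map_pmf (\<lambda>(m, l, g, a, y, t). t) (law C)) \<sigma> - ideal C (\<lambda>m l g a y t. \<sigma> t) \<le> devE C"
    using law_close_to_ideal[of "\<lambda>m l g a y t. \<sigma> t" 1 C] \<sigma> by (simp add: case_prod_unfold)
  moreover have "ideal C (\<lambda>m l g a y t. \<sigma> t) - \<E> qT \<sigma> \<le> devT C"
  proof -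
    let ?s = "\<lambda>t. (\<Sum>i\<in>I. dens pT (C i) t) / card I"
    have "ideal C (\<lambda>m l g a y t. \<sigma> t) - \<E> qT \<sigma> = \<E> qT (\<lambda>t. (?s t - 1) * \<sigma> t)"
      unfolding ideal_T[OF C] using fin_marginals by (simp add: \<E>_diff left_diff_distrib)
    also have "\<dots> \<le> \<E> qT (\<lambda>t. \<bar>1 - ?s t\<bar>)"
    proof (rule \<E>_mono)
      fix t
      have "(?s t - 1) * \<sigma> t \<le> \<bar>?s t - 1\<bar> * \<bar>\<sigma> t\<bar>" by (metis abs_ge_self abs_mult)
      also have "\<dots> \<le> \<bar>?s t - 1\<bar>" using \<sigma>[of t] by (simp add: mult_left_le)
      finally show "(?s t - 1) * \<sigma> t \<le> \<bar>1 - ?s t\<bar>" by (simp add: abs_minus_commute)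
    qed (rule fin_marginals)
    finally show ?thesis by (simp add: devT_def)
  qed
  ultimately show ?thesis by linarith
qed

text \<open>Only the codewords of one bin, the slice with \<open>m\<close> and \<open>g\<close>
  fixed, take part in this covering. Hence soft covering is applied to a subset of the index set
  over which the codebook is drawn.\<close>

lemma \<E>_devE:
  assumes "T > 0"
  shows "\<E> codebook devE \<le> sqrt (T / card L) + 2 * measure_pmf.prob pE {(a, b). dens pE a b > T}"
    (is "_ \<le> ?b")
proof -
  let ?f = "\<lambda>m g C. \<E> qE (\<lambda>x. \<bar>1 - (\<Sum>l\<in>L. dens pE (C (m, l, g)) x) / card L\<bar>)"
  have *: "\<E> codebook (?f m g) \<le> ?b" if "m \<in> M" "g \<in> G" for m g
  proof -
    let ?A = "(\<lambda>l. (m, l, g)) ` L"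
    have inj: "inj_on (\<lambda>l. (m, l, g)) L" by (simp add: inj_on_def)
    show ?thesis
      using soft_covering[OF fin_marginals(2) finI(1), of ?A T u0] that finL assms
      by (simp add: card_image[OF inj] sum.reindex[OF inj] fst_marginals snd_pE codebook_def I_def
          image_subset_iff del: integral_map_pmf)
  qed
  have "\<E> codebook devE = (\<Sum>m\<in>M. (\<Sum>g\<in>G. \<E> codebook (?f m g)) / card G) / card M"
    unfolding devE_def using fin_codebook by (simp add: \<E>_sum)
  also have "\<dots> \<le> ?b"
    using finM finG * by (intro average_le_const) auto
  finally show ?thesis .
qed

lemma \<E>_devT:
  assumes "T > 0"
  shows "\<E> codebook devT \<le> sqrt (T / card I) + 2 * measure_pmf.prob pT {(a, b). dens pT a b > T}"
  using soft_covering[OF fin_marginals(4) finI(1) subset_refl finI(2) assms, of u0]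
  unfolding devT_def qT_def[symmetric] fst_marginals codebook_def .

lemma \<E>_ideal:
  "\<E> codebook (\<lambda>C. ideal C (\<lambda>m l g a y t. \<psi> a y t)) = \<E> J (\<lambda>(u, a, y, t). \<psi> a y t)"
proof -
  have *: "\<E> codebook (\<lambda>C. cE (C i) \<psi>) = \<E> J (\<lambda>(u, a, y, t). \<psi> a y t)" if "i \<in> I" for i
    using \<E>_Pi_component[OF finI(1) that, of u0 "\<lambda>_. qU" "\<lambda>u. cE u \<psi>"] \<E>_cE[of "\<lambda>_. \<psi>"]
    by (simp add: codebook_def)
  have "\<E> codebook (\<lambda>C. ideal C (\<lambda>m l g a y t. \<psi> a y t)) =
     (\<Sum>m\<in>M. (\<Sum>g\<in>G. (\<Sum>l\<in>L. \<E> codebook (\<lambda>C. cE (C (m, l, g)) \<psi>)) / card L) / card G) / card M"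
    unfolding ideal_def using fin_codebook by (simp add: \<E>_sum)
  also have "\<dots> = \<E> J (\<lambda>(u, a, y, t). \<psi> a y t)"
    using cards * by (simp add: I_def)
  finally show ?thesis .
qed

text \<open>The bin index is decoded jointly with the message and then dropped. Any pair above the
  threshold may be chosen; the analysis asks only that no wrong pair be above it.\<close>

definition dec :: "real \<Rightarrow> ('m \<times> 'l \<times> 'g \<Rightarrow> 'u) \<Rightarrow> 'y \<Rightarrow> 'g \<Rightarrow> 'm" where
  "dec T C y g = (if \<exists>k\<in>M \<times> L. dens pY (C (fst k, snd k, g)) y > T
     then fst (SOME k. k \<in> M \<times> L \<and> dens pY (C (fst k, snd k, g)) y > T) else SOME m. m \<in> M)"

lemma dec_in: "dec T C y g \<in> M"
proof (cases "\<exists>k\<in>M \<times> L. dens pY (C (fst k, snd k, g)) y > T")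
  case True
  then have "(SOME k. k \<in> M \<times> L \<and> dens pY (C (fst k, snd k, g)) y > T) \<in> M \<times> L"
    by (metis (mono_tags, lifting) someI_ex)
  then show ?thesis using True by (auto simp: dec_def)
next
  case False
  have "(SOME m. m \<in> M) \<in> M" using finM by (simp add: some_in_eq)
  then show ?thesis using False by (auto simp: dec_def)
qed

definition err :: "real \<Rightarrow> ('m \<times> 'l \<times> 'g \<Rightarrow> 'u) \<Rightarrow> real" where
  "err T C = ideal C (\<lambda>m l g a y t. of_bool (dec T C y g \<noteq> m))"

lemma dec_error:
  assumes "m \<in> M" "l \<in> L"
  shows "of_bool (dec T C y g \<noteq> m) \<le> of_bool (dens pY (C (m, l, g)) y \<le> T) +
    (\<Sum>k\<in>M \<times> L - {(m, l)}. of_bool (dens pY (C (fst k, snd k, g)) y > T) :: real)"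
proof (cases "dec T C y g \<noteq> m \<and> dens pY (C (m, l, g)) y > T")
  case True
  then have ex: "\<exists>k. k \<in> M \<times> L \<and> dens pY (C (fst k, snd k, g)) y > T" using assms by force
  define k where "k = (SOME k. k \<in> M \<times> L \<and> dens pY (C (fst k, snd k, g)) y > T)"
  have k: "k \<in> M \<times> L \<and> dens pY (C (fst k, snd k, g)) y > T"
    unfolding k_def by (rule someI_ex[OF ex])
  have "dec T C y g = fst k" using ex unfolding dec_def k_def by auto
  with True have "k \<noteq> (m, l)" by auto
  then have "of_bool (dens pY (C (fst k, snd k, g)) y > T) \<le>
     (\<Sum>k\<in>M \<times> L - {(m, l)}. of_bool (dens pY (C (fst k, snd k, g)) y > T) :: real)"
    using k finM finL by (intro member_le_sum) auto
  then show ?thesis using k True by simp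
next
  case False
  have "0 \<le> (\<Sum>k\<in>M \<times> L - {(m, l)}. of_bool (dens pY (C (fst k, snd k, g)) y > T) :: real)"
    by (rule sum_nonneg) simp
  then show ?thesis using False by (auto simp: not_less)
qed

text \<open>A lone message cannot be confused, whatever the threshold. This frees the bin rate from
  the packing condition at \<open>R = 0\<close>.\<close>

lemma err_card1:
  assumes "card M = 1"
  shows "err T C = 0"
proof -
  obtain m0 where "M = {m0}" using assms card_1_singletonE by blast
  then have "dec T C y g = m" if "m \<in> M" for m y g using dec_in[of T C y g] that by auto
  then show ?thesis by (simp add: err_def ideal_def cE_def case_prod_unfold cong: sum.cong_simp)
qed

text \<open>Union bound after a change of measure: weighting by the density ratio of the true
  codeword makes the output independent of the codebook. A competing codeword is independent of the
  true one and has a density ratio of mean 1, so by Markov's inequality it passes the threshold with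
  probability at most \<open>1 / T\<close>.\<close>

lemma \<E>_err:
  assumes T: "T > 0"
  shows "\<E> codebook (err T) \<le> measure_pmf.prob pY {(a, b). dens pY a b \<le> T} + card M * card L / T"
    (is "_ \<le> ?b")
proof -
  have main: "\<E> codebook (\<lambda>C. cE (C (m, l, g)) (\<lambda>a y t. of_bool (dec T C y g \<noteq> m))) \<le> ?b"
    if mlg: "m \<in> M" "l \<in> L" "g \<in> G" for m l g
  proof -
    let ?D = "\<lambda>C y. dens pY (C (m, l, g)) y"
    let ?A = "M \<times> L - {(m, l)}"
    let ?o = "\<lambda>k C y. of_bool (dens pY (C (fst k, snd k, g)) y > T) :: real"
    have i: "(m, l, g) \<in> I" using mlg by (simp add: I_def)
    have "\<E> codebook (\<lambda>C. cE (C (m, l, g)) (\<lambda>a y t. of_bool (dec T C y g \<noteq> m))) \<le>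
        \<E> codebook (\<lambda>C. \<E> qY (\<lambda>y. ?D C y * of_bool (?D C y \<le> T) + (\<Sum>k\<in>?A. ?D C y * ?o k C y)))"
    proof (rule \<E>_mono[OF fin_codebook])
      fix C assume "C \<in> set_pmf codebook"
      then have u: "C (m, l, g) \<in> set_pmf qU" using i by (rule set_codebook)
      have "cE (C (m, l, g)) (\<lambda>a y t. of_bool (dec T C y g \<noteq> m)) = \<E> qY (\<lambda>y. ?D C y * of_bool (dec T C y g \<noteq> m))"
        by (rule cE_Y[OF u])
      also have "\<dots> \<le> \<E> qY (\<lambda>y. ?D C y * (of_bool (?D C y \<le> T) + (\<Sum>k\<in>?A. ?o k C y)))"
        using dec_error[OF mlg(1,2)] by (intro \<E>_mono fin_marginals mult_left_mono dens_nonneg) auto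
      finally show "cE (C (m, l, g)) (\<lambda>a y t. of_bool (dec T C y g \<noteq> m)) \<le>
         \<E> qY (\<lambda>y. ?D C y * of_bool (?D C y \<le> T) + (\<Sum>k\<in>?A. ?D C y * ?o k C y))"
        by (simp add: distrib_left sum_distrib_left)
    qed
    also have "\<dots> = \<E> qY (\<lambda>y. \<E> codebook (\<lambda>C. ?D C y * of_bool (?D C y \<le> T) + (\<Sum>k\<in>?A. ?D C y * ?o k C y)))"
      by (rule \<E>_swap) (use fin_codebook fin_marginals in auto)
    also have "\<dots> \<le> \<E> qY (\<lambda>y. \<E> qU (\<lambda>u. dens pY u y * of_bool (dens pY u y \<le> T)) + card M * card L / T)"
    proof (rule \<E>_mono)
      fix y assume y: "y \<in> set_pmf qY"
      have one: "\<E> qU (\<lambda>u. dens pY u y) = 1"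
        using \<E>_dens_fst[OF fin_marginals(3), of y] y by (simp only: fst_marginals qY_def)
      have 1: "\<E> codebook (\<lambda>C. ?D C y * of_bool (?D C y \<le> T)) = \<E> qU (\<lambda>u. dens pY u y * of_bool (dens pY u y \<le> T))"
        unfolding codebook_def
        by (rule \<E>_Pi_component[OF finI(1) i, where k = "\<lambda>u. dens pY u y * of_bool (dens pY u y \<le> T)"])
      have 2: "\<E> codebook (\<lambda>C. ?D C y * ?o k C y) \<le> 1 / T" if k: "k \<in> ?A" for k
      proof -
        have "\<E> codebook (\<lambda>C. ?D C y * ?o k C y) =
           \<E> qU (\<lambda>u. dens pY u y) * \<E> qU (\<lambda>u. of_bool (dens pY u y > T))"
          unfolding codebook_def using k mlg finI fin_marginals
          by (intro \<E>_Pi_two_components[where k = "\<lambda>u. dens pY u y" and h = "\<lambda>u. of_bool (dens pY u y > T)"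
                and p = "\<lambda>_. qU"]) (auto simp: I_def)
        also have "\<dots> \<le> \<E> qU (\<lambda>u. dens pY u y / T)"
          unfolding one mult_1_left using T
          by (intro \<E>_mono fin_marginals) (auto simp: dens_nonneg le_divide_eq)
        also have "\<dots> = 1 / T" using one by simp
        finally show ?thesis .
      qed
      have "(\<Sum>k\<in>?A. \<E> codebook (\<lambda>C. ?D C y * ?o k C y)) \<le> card ?A * (1 / T)"
        using sum_bounded_above[of ?A "\<lambda>k. \<E> codebook (\<lambda>C. ?D C y * ?o k C y)" "1 / T"] 2 by simp
      also have "\<dots> \<le> real (card (M \<times> L)) * (1 / T)"
      proof (rule mult_right_mono)
        have "card ?A \<le> card (M \<times> L)" using finM finL by (intro card_mono) auto
        then show "real (card ?A) \<le> real (card (M \<times> L))" by (rule of_nat_mono)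
      qed (use T in simp)
      finally have 3: "(\<Sum>k\<in>?A. \<E> codebook (\<lambda>C. ?D C y * ?o k C y)) \<le> card M * card L / T"
        by (simp add: card_cartesian_product)
      show "\<E> codebook (\<lambda>C. ?D C y * of_bool (?D C y \<le> T) + (\<Sum>k\<in>?A. ?D C y * ?o k C y)) \<le>
         \<E> qU (\<lambda>u. dens pY u y * of_bool (dens pY u y \<le> T)) + card M * card L / T"
        using 1 3 fin_codebook by (simp only: \<E>_add \<E>_sum)
    qed (rule fin_marginals)
    also have "\<dots> = \<E> qY (\<lambda>y. \<E> qU (\<lambda>u. dens pY u y * of_bool (dens pY u y \<le> T))) + card M * card L / T"
      using fin_marginals by (simp add: \<E>_add)
    also have "\<E> qY (\<lambda>y. \<E> qU (\<lambda>u. dens pY u y * of_bool (dens pY u y \<le> T))) =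
        \<E> qU (\<lambda>u. \<E> qY (\<lambda>y. dens pY u y * of_bool (dens pY u y \<le> T)))"
      by (rule \<E>_swap) (use fin_marginals in auto)
    also have "\<dots> = \<E> pY (\<lambda>(u, y). of_bool (dens pY u y \<le> T))"
      unfolding qY_def fst_marginals(2)[symmetric] by (rule \<E>_dens[OF fin_marginals(3)])
    also have "\<dots> = measure_pmf.prob pY {(a, b). dens pY a b \<le> T}"
      using \<E>_of_bool[of pY "\<lambda>(u, v). dens pY u v \<le> T"] by (simp add: case_prod_unfold)
    finally show ?thesis .
  qed
  have "\<E> codebook (err T) = (\<Sum>m\<in>M. (\<Sum>g\<in>G. (\<Sum>l\<in>L.
      \<E> codebook (\<lambda>C. cE (C (m, l, g)) (\<lambda>a y t. of_bool (dec T C y g \<noteq> m)))) / card L) / card G) / card M"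
    unfolding err_def ideal_def using fin_codebook by (simp add: \<E>_sum)
  also have "\<dots> \<le> ?b"
    using finM finG finL by (intro average_le_const main) auto
  finally show ?thesis .
qed

text \<open>
  A single codebook that is good in all respects comes from averaging the one quantity
  \<open>distortion + k * (errors)\<close>: the errors are then at most \<open>D / k\<close>, and with \<open>k \<ge> 2 * B\<close> the
  same bound also pays for the extra distortion of the encoder and of the coupling.
\<close>

theorem one_shot_code:
  fixes \<delta> :: "'a \<Rightarrow> 't \<Rightarrow> real"
  assumes \<delta>: "\<And>a t. 0 \<le> \<delta> a t" "\<And>a t. \<delta> a t \<le> B"
    and T: "T1 > 0" "T2 > 0" "T3 > 0" and k: "k > 0" "2 * B \<le> k"
    and \<epsilon>1: "sqrt (T1 / card L) + 2 * measure_pmf.prob pE {(a, b). dens pE a b > T1} \<le> \<epsilon>1"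
    and \<epsilon>2: "sqrt (T2 / (card M * card L * card G)) + 2 * measure_pmf.prob pT {(a, b). dens pT a b > T2} \<le> \<epsilon>2"
    and \<epsilon>3: "card M = 1 \<and> 0 \<le> \<epsilon>3 \<or>
       measure_pmf.prob pY {(a, b). dens pY a b \<le> T3} + card M * card L / T3 \<le> \<epsilon>3"
    and D: "\<E> J (\<lambda>(u, a, y, t). \<delta> a t) + k * (\<epsilon>1 + \<epsilon>2 + \<epsilon>3) \<le> D"
  obtains C :: "'m \<times> 'l \<times> 'g \<Rightarrow> 'u" and lk dc \<kappa> Q where
    "\<And>y g. dc y g \<in> M" "\<And>x. set_pmf (\<kappa> x) \<subseteq> insert x (set_pmf qT)"
    "Q = do {m \<leftarrow> pmf_of_set M; g \<leftarrow> pmf_of_set G; a \<leftarrow> P; l \<leftarrow> lk m g (e a);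
       (y, t) \<leftarrow> K (C (m, l, g)) a; t' \<leftarrow> \<kappa> t; return_pmf (m, dc y g, a, t')}"
    "map_pmf (\<lambda>(m, m', a, t). t) Q = qT"
    "\<E> Q (\<lambda>(m, m', a, t). of_bool (m \<noteq> m')) \<le> D / k"
    "\<E> Q (\<lambda>(m, m', a, t). \<delta> a t) \<le> D"
proof -
  have "0 \<le> B" using \<delta> by (meson order_trans)
  define dist where "dist C = ideal C (\<lambda>m l g a y t. \<delta> a t)" for C
  have "\<E> codebook (\<lambda>C. dist C + k * (devE C + devT C + err T3 C)) =
      \<E> J (\<lambda>(u, a, y, t). \<delta> a t) + k * (\<E> codebook devE + \<E> codebook devT + \<E> codebook (err T3))"
    using fin_codebook \<E>_ideal[of "\<lambda>a y t. \<delta> a t"] by (simp add: \<E>_add dist_def)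
  also have "\<dots> \<le> \<E> J (\<lambda>(u, a, y, t). \<delta> a t) + k * (\<epsilon>1 + \<epsilon>2 + \<epsilon>3)"
  proof (intro add_left_mono mult_left_mono add_mono)
    show "\<E> codebook devE \<le> \<epsilon>1" using \<E>_devE[OF T(1)] \<epsilon>1 by linarith
    show "\<E> codebook devT \<le> \<epsilon>2" using \<E>_devT[OF T(2)] \<epsilon>2
      by (simp add: I_def card_cartesian_product mult.assoc)
    show "\<E> codebook (err T3) \<le> \<epsilon>3"
      using \<epsilon>3
    proof
      assume "card M = 1 \<and> 0 \<le> \<epsilon>3"
      then show ?thesis using \<E>_cong[of codebook "err T3" "\<lambda>_. 0"] by (simp add: err_card1)
    qed (use \<E>_err[OF T(3)] in linarith)
  qed (use k in auto)
  finally obtain C where C: "C \<in> set_pmf codebook"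
    and le: "dist C + k * (devE C + devT C + err T3 C) \<le> D"
    using exists_le_\<E>[OF fin_codebook] D by (meson order_trans)
  define p where "p = map_pmf (\<lambda>(m, l, g, a, y, t). t) (law C)"
  have finp: "finite (set_pmf p)" using fin_law by (simp add: p_def)
  have close: "\<E> p \<sigma> - \<E> qT \<sigma> \<le> devE C + devT C" if "\<And>t. \<bar>\<sigma> t\<bar> \<le> 1" for \<sigma>
    using law_T_close[OF C that] by (simp only: p_def)
  obtain \<kappa> where \<kappa>: "bind_pmf p \<kappa> = qT" "\<And>x. set_pmf (\<kappa> x) \<subseteq> insert x (set_pmf qT)"
    "\<E> p (\<lambda>x. measure_pmf.prob (\<kappa> x) {y. y \<noteq> x}) \<le> devE C + devT C"
    by (rule coupling_kernel[OF finp fin_marginals(7)]) (rule close, blast, blast)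
  have fin\<kappa>: "finite (set_pmf (\<kappa> x))" for x
    by (rule finite_subset[OF \<kappa>(2)]) (simp add: fin_marginals)
  define Q where "Q = bind_pmf (law C) (\<lambda>(m, l, g, a, y, t). map_pmf (\<lambda>t'. (m, dec T3 C y g, a, t')) (\<kappa> t))"
  have \<E>Q: "\<E> Q f = \<E> (law C) (\<lambda>(m, l, g, a, y, t). \<E> (\<kappa> t) (\<lambda>t'. f (m, dec T3 C y g, a, t')))" for f
    unfolding Q_def using fin_law fin\<kappa> by (subst \<E>_bind) (auto simp: case_prod_unfold)
  have dev0: "0 \<le> devE C" unfolding devE_def
    by (intro divide_nonneg_nonneg sum_nonneg \<E>_nonneg) auto
  have devT0: "0 \<le> devT C" unfolding devT_def by (intro \<E>_nonneg) auto
  have err0: "0 \<le> err T3 C" unfolding err_def ideal_def cE_def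
    by (intro divide_nonneg_nonneg sum_nonneg \<E>_nonneg mult_nonneg_nonneg dens_nonneg) auto
  have dist0: "0 \<le> dist C" unfolding dist_def ideal_def cE_def
    by (intro divide_nonneg_nonneg sum_nonneg \<E>_nonneg mult_nonneg_nonneg dens_nonneg) (auto simp: \<delta>)
  show ?thesis
  proof (rule that[of "dec T3 C" \<kappa> Q "lik C" C])
    show "Q = do {m \<leftarrow> pmf_of_set M; g \<leftarrow> pmf_of_set G; a \<leftarrow> P; l \<leftarrow> lik C m g (e a);
       (y, t) \<leftarrow> K (C (m, l, g)) a; t' \<leftarrow> \<kappa> t; return_pmf (m, dec T3 C y g, a, t')}"
      unfolding Q_def law_def
      by (simp add: bind_assoc_pmf bind_return_pmf map_pmf_def case_prod_unfold)
    show "map_pmf (\<lambda>(m, m', a, t). t) Q = qT"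
      unfolding Q_def \<kappa>(1)[symmetric] p_def
      by (simp add: map_bind_pmf bind_map_pmf map_pmf_comp case_prod_unfold)
    have "\<E> Q (\<lambda>(m, m', a, t). of_bool (m \<noteq> m')) =
        \<E> (law C) (\<lambda>(m, l, g, a, y, t). of_bool (dec T3 C y g \<noteq> m))"
      unfolding \<E>Q by (intro \<E>_cong) auto
    also have "\<dots> \<le> err T3 C + devE C"
      using law_close_to_ideal[of "\<lambda>m l g a y t. of_bool (dec T3 C y g \<noteq> m)" 1 C]
      by (simp add: err_def)
    also have "\<dots> \<le> devE C + devT C + err T3 C" using devT0 by simp
    also have "\<dots> \<le> D / k" using le dist0 k by (simp add: field_simps)
    finally show "\<E> Q (\<lambda>(m, m', a, t). of_bool (m \<noteq> m')) \<le> D / k" .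
    have "\<E> Q (\<lambda>(m, m', a, t). \<delta> a t) = \<E> (law C) (\<lambda>(m, l, g, a, y, t). \<E> (\<kappa> t) (\<delta> a))"
      unfolding \<E>Q by (intro \<E>_cong) auto
    also have "\<dots> \<le> \<E> (law C) (\<lambda>(m, l, g, a, y, t). \<delta> a t + B * measure_pmf.prob (\<kappa> t) {t'. t' \<noteq> t})"
    proof (rule \<E>_mono[OF fin_law])
      fix x assume "x \<in> set_pmf (law C)"
      obtain m l g a y t where x: "x = (m, l, g, a, y, t)" by (metis surj_pair)
      have "\<E> (\<kappa> t) (\<delta> a) \<le> \<E> (\<kappa> t) (\<lambda>t'. \<delta> a t + B * of_bool (t' \<noteq> t))"
        using \<delta> by (intro \<E>_mono[OF fin\<kappa>]) (auto simp: add_increasing)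
      also have "\<dots> = \<delta> a t + B * measure_pmf.prob (\<kappa> t) {t'. t' \<noteq> t}"
        unfolding \<E>_of_bool[symmetric] using fin\<kappa> by (simp add: \<E>_add)
      finally show "(case x of (m, l, g, a, y, t) \<Rightarrow> \<E> (\<kappa> t) (\<delta> a)) \<le>
         (case x of (m, l, g, a, y, t) \<Rightarrow> \<delta> a t + B * measure_pmf.prob (\<kappa> t) {t'. t' \<noteq> t})"
        by (simp add: x)
    qed
    also have "\<dots> = \<E> (law C) (\<lambda>(m, l, g, a, y, t). \<delta> a t) + B * \<E> p (\<lambda>x. measure_pmf.prob (\<kappa> x) {y. y \<noteq> x})"
      unfolding p_def using fin_law by (simp add: case_prod_unfold \<E>_add)
    also have "\<E> (law C) (\<lambda>(m, l, g, a, y, t). \<delta> a t) \<le> dist C + B * devE C"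
      using law_close_to_ideal[of "\<lambda>m l g a y t. \<delta> a t" B C] \<delta> by (simp add: dist_def)
    also have "B * \<E> p (\<lambda>x. measure_pmf.prob (\<kappa> x) {y. y \<noteq> x}) \<le> B * (devE C + devT C)"
      using \<kappa>(3) \<open>0 \<le> B\<close> by (rule mult_left_mono)
    \<comment> \<open>One \<open>B * devE C\<close> comes from leaving the ideal law, the other from
      the coupling; together they account for \<open>2 * B \<le> k\<close>.\<close>
    finally have "\<E> Q (\<lambda>(m, m', a, t). \<delta> a t) \<le> dist C + 2 * B * devE C + B * devT C"
      by (simp add: algebra_simps)
    also have "\<dots> \<le> dist C + k * devE C + k * devT C"
      using k dev0 devT0 \<open>0 \<le> B\<close> by (intro add_mono mult_right_mono) auto
    also have "\<dots> \<le> dist C + k * (devE C + devT C + err T3 C)"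
      using k err0 by (simp add: algebra_simps)
    also have "\<dots> \<le> D" by (rule le)
    finally show "\<E> Q (\<lambda>(m, m', a, t). \<delta> a t) \<le> D" .
  qed (use \<kappa> dec_in in auto)
qed

end

subsection \<open>Block versions of single-letter laws\<close>

text \<open>A pair of sequences instead of a sequence of pairs, so that \<open>dens\<close> applies
  to blocks. With this default both components are \<open>undefined\<close> outside the block, and
  the marginals are again product laws.\<close>

definition block_pair_pmf :: "nat \<Rightarrow> ('a \<times> 'b) pmf \<Rightarrow> ((nat \<Rightarrow> 'a) \<times> (nat \<Rightarrow> 'b)) pmf" where
  "block_pair_pmf n p = map_pmf (\<lambda>F. (fst \<circ> F, snd \<circ> F)) (Pi_pmf {..<n} (undefined, undefined) (\<lambda>_. p))"

lemma inj_unzip: "inj (\<lambda>F. (fst \<circ> F, snd \<circ> F))"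
  by (auto simp: inj_def fun_eq_iff prod_eq_iff)

lemma block_pair_map:
  assumes "f dd = undefined" "g dd = undefined"
  shows "map_pmf (\<lambda>F. (f \<circ> F, g \<circ> F)) (Pi_pmf {..<n} dd (\<lambda>_. J)) = block_pair_pmf n (map_pmf (\<lambda>x. (f x, g x)) J)"
proof -
  have "Pi_pmf {..<n} (undefined, undefined) (\<lambda>_. map_pmf (\<lambda>x. (f x, g x)) J) =
      map_pmf (\<lambda>h. (\<lambda>x. (f x, g x)) \<circ> h) (Pi_pmf {..<n} dd (\<lambda>_. J))"
    using assms by (intro Pi_pmf_map) auto
  then show ?thesis by (simp add: block_pair_pmf_def map_pmf_comp o_def)
qed

lemma map_fst_block_pair: "map_pmf fst (block_pair_pmf n p) = Pi_pmf {..<n} undefined (\<lambda>_. map_pmf fst p)"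
  by (subst Pi_pmf_map[where dflt = "(undefined, undefined)"]) (auto simp: block_pair_pmf_def map_pmf_comp)

lemma map_snd_block_pair: "map_pmf snd (block_pair_pmf n p) = Pi_pmf {..<n} undefined (\<lambda>_. map_pmf snd p)"
  by (subst Pi_pmf_map[where dflt = "(undefined, undefined)"]) (auto simp: block_pair_pmf_def map_pmf_comp)

text \<open>Unzipping is injective, so the joint mass factorises over positions, as do both
  marginals. Membership in the support fixes the values outside the block, which the product formula
  for \<open>Pi_pmf\<close> needs.\<close>

lemma dens_block_pair:
  assumes "F \<in> set_pmf (Pi_pmf {..<n} (undefined, undefined) (\<lambda>_. p))"
  shows "dens (block_pair_pmf n p) (fst \<circ> F) (snd \<circ> F) = (\<Prod>i<n. dens p (fst (F i)) (snd (F i)))"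
proof -
  have out: "F i = (undefined, undefined)" if "i \<notin> {..<n}" for i
    using assms set_Pi_pmf_subset[of "{..<n}" "(undefined, undefined)" "\<lambda>_. p"] that by auto
  have "pmf (block_pair_pmf n p) (fst \<circ> F, snd \<circ> F) = (\<Prod>i<n. pmf p (F i))"
    unfolding block_pair_pmf_def
    using pmf_map_inj'[OF inj_unzip, of "Pi_pmf {..<n} (undefined, undefined) (\<lambda>_. p)" F]
      pmf_Pi'[of "{..<n}" F "(undefined, undefined)" "\<lambda>_. p"] out by simp
  moreover have "pmf (map_pmf fst (block_pair_pmf n p)) (fst \<circ> F) = (\<Prod>i<n. pmf (map_pmf fst p) (fst (F i)))"
    unfolding map_fst_block_pair using out by (subst pmf_Pi') auto
  moreover have "pmf (map_pmf snd (block_pair_pmf n p)) (snd \<circ> F) = (\<Prod>i<n. pmf (map_pmf snd p) (snd (F i)))"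
    unfolding map_snd_block_pair using out by (subst pmf_Pi') auto
  ultimately show ?thesis by (simp add: dens_def prod.distrib prod_dividef)
qed

subsection \<open>Concentration of the information density\<close>

text \<open>Mutual information in bits, as the mean of the information density.\<close>

definition info :: "('a \<times> 'b) pmf \<Rightarrow> real" where
  "info p = \<E> p (\<lambda>(a, b). log 2 (dens p a b))"

lemma dens_pos: "(a, b) \<in> set_pmf p \<Longrightarrow> 0 < dens p a b"
  using pmf_eq_dens[of p a b] dens_nonneg[of p a b] by (fastforce simp: set_pmf_iff)

text \<open>Apply \<open>ln x \<le> x - 1\<close> to the reciprocal of the density ratio. The mean
  of that reciprocal is only bounded by 1, because the product of the marginals may charge pairs
  outside the support of \<open>p\<close>.\<close>

lemma info_nonneg:
  assumes fin: "finite (set_pmf p)"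
  shows "0 \<le> info p"
proof -
  have "\<E> p (\<lambda>(a, b). 1 / dens p a b) \<le> 1"
  proof -
    have "\<E> p (\<lambda>(a, b). 1 / dens p a b) =
        \<E> (map_pmf fst p) (\<lambda>a. \<E> (map_pmf snd p) (\<lambda>b. dens p a b * (1 / dens p a b)))"
      by (rule \<E>_dens[OF fin, symmetric])
    also have "\<dots> \<le> 1"
      using fin by (intro \<E>_le_const) auto
    finally show ?thesis .
  qed
  then have "0 \<le> \<E> p (\<lambda>(a, b). (1 - 1 / dens p a b) / ln 2)"
    using fin by (simp add: case_prod_unfold \<E>_diff)
  also have "\<dots> \<le> info p"
    unfolding info_def
  proof (rule \<E>_mono[OF fin], clarsimp)
    fix a b assume "(a, b) \<in> set_pmf p"
    then have "0 < dens p a b" by (rule dens_pos)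
    then have "1 - 1 / dens p a b \<le> ln (dens p a b)"
      using ln_le_minus_one[of "1 / dens p a b"] by (simp add: ln_div)
    then show "(1 - 1 / dens p a b) / ln 2 \<le> log 2 (dens p a b)"
      by (simp add: log_def divide_right_mono)
  qed
  finally show ?thesis .
qed

lemma Hoeffding_iid:
  fixes p :: "'a pmf" and f :: "'a \<Rightarrow> real"
  assumes fin: "finite (set_pmf p)" and "\<delta> > 0"
  shows "\<exists>c>0. \<forall>n>(0::nat).
     measure_pmf.prob (Pi_pmf {..<n} d (\<lambda>_. p)) {F. (\<Sum>i<n. f (F i)) \<ge> n * (\<E> p f + \<delta>)} \<le> exp (- c * n) \<and>
     measure_pmf.prob (Pi_pmf {..<n} d (\<lambda>_. p)) {F. (\<Sum>i<n. f (F i)) \<le> n * (\<E> p f - \<delta>)} \<le> exp (- c * n)"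
proof -
  \<comment> \<open>The summand 1 keeps the intervals for Hoeffding's inequality nondegenerate even
    if \<open>f\<close> vanishes.\<close>
  define m where "m = 1 + (\<Sum>x\<in>set_pmf p. \<bar>f x\<bar>)"
  have "m > 0" unfolding m_def by (simp add: add_pos_nonneg sum_nonneg)
  have m: "\<bar>f x\<bar> \<le> m" if "x \<in> set_pmf p" for x
    using member_le_sum[of x "set_pmf p" "\<lambda>x. \<bar>f x\<bar>"] that fin by (simp add: m_def)
  \<comment> \<open>With deviation \<open>n * \<delta>\<close> and \<open>n\<close> intervals of
    length \<open>2 * m\<close>, Hoeffding's exponent is
    \<open>2 * (n * \<delta>)^2 / (n * (2 * m)^2)\<close>, which is \<open>c * n\<close>.\<close>
  define c where "c = \<delta>\<^sup>2 / (2 * m\<^sup>2)"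
  have bounds: "measure_pmf.prob (Pi_pmf {..<n} d (\<lambda>_. p)) {F. (\<Sum>i<n. f (F i)) \<ge> n * (\<E> p f + \<delta>)} \<le> exp (- c * n) \<and>
     measure_pmf.prob (Pi_pmf {..<n} d (\<lambda>_. p)) {F. (\<Sum>i<n. f (F i)) \<le> n * (\<E> p f - \<delta>)} \<le> exp (- c * n)"
    if "n > 0" for n :: nat
  proof -
    let ?P = "Pi_pmf {..<n} d (\<lambda>_. p)"
    interpret indep_interval_bounded_random_variables "measure_pmf ?P" "{..<n}" "\<lambda>i F. f (F i)" "\<lambda>_. - m" "\<lambda>_. m"
    proof
      show "prob_space.indep_vars (measure_pmf ?P) (\<lambda>_. borel) (\<lambda>i F. f (F i)) {..<n}"
        using prob_space.indep_vars_compose2[OF prob_space_measure_pmf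
            indep_vars_Pi_pmf[OF finite_lessThan, of n d "\<lambda>_. p"],
            of "\<lambda>_. f" "\<lambda>_. borel"] by simp
      fix i assume "i \<in> {..<n}"
      then have "F i \<in> set_pmf p" if "F \<in> set_pmf ?P" for F
        using that by (simp add: set_Pi_pmf PiE_dflt_def)
      then show "AE F in measure_pmf ?P. f (F i) \<in> {- m..m}"
        using m by (fastforce simp: AE_measure_pmf_iff abs_le_iff)
    qed auto
    interpret Hoeffding_ineq "measure_pmf ?P" "{..<n}" "\<lambda>i F. f (F i)" "\<lambda>_. - m" "\<lambda>_. m"
      "\<Sum>i\<in>{..<n}. \<E> ?P (\<lambda>F. f (F i))"
      by unfold_locales
    have \<mu>: "(\<Sum>i\<in>{..<n}. \<E> ?P (\<lambda>F. f (F i))) = n * \<E> p f"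
      using \<E>_Pi_component[of "{..<n}" _ d "\<lambda>_. p" f] by simp
    have pos: "(\<Sum>i\<in>{..<n}. (m - (- m))\<^sup>2) > 0" using that \<open>m > 0\<close> by simp
    have ex: "-2 * (n * \<delta>)\<^sup>2 / (\<Sum>i\<in>{..<n}. (m - (- m))\<^sup>2) = - c * n"
      using that \<open>m > 0\<close> by (simp add: c_def field_simps power2_eq_square)
    show ?thesis
      using Hoeffding_ineq_ge[of "n * \<delta>", OF _ pos] Hoeffding_ineq_le[of "n * \<delta>", OF _ pos] \<open>\<delta> > 0\<close>
      unfolding \<mu> ex by (simp add: algebra_simps)
  qed
  show ?thesis
    using bounds \<open>m > 0\<close> \<open>\<delta> > 0\<close> by (intro exI[of _ c]) (auto simp: c_def)
qed

text \<open>On the support the logarithm of the block density ratio is a sum of independent copies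
  of the single-letter information density, whose mean is \<open>info p\<close>.\<close>

lemma prob_block_dens:
  assumes fin: "finite (set_pmf p)" and "\<delta> > 0"
  shows "(\<lambda>n. measure_pmf.prob (block_pair_pmf n p)
      {(a, b). dens (block_pair_pmf n p) a b > 2 powr (n * (info p + \<delta>))}) \<longlonglongrightarrow> 0" (is "?f \<longlonglongrightarrow> 0")
    and "(\<lambda>n. measure_pmf.prob (block_pair_pmf n p)
      {(a, b). dens (block_pair_pmf n p) a b \<le> 2 powr (n * (info p - \<delta>))}) \<longlonglongrightarrow> 0" (is "?g \<longlonglongrightarrow> 0")
proof -
  let ?i = "\<lambda>x. log 2 (dens p (fst x) (snd x))"
  let ?P = "\<lambda>n. Pi_pmf {..<n::nat} (undefined, undefined) (\<lambda>_. p)"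
  have info: "\<E> p ?i = info p" by (simp add: info_def case_prod_unfold)
  obtain c where c: "c > 0" "\<And>n. n > 0 \<Longrightarrow>
     measure_pmf.prob (?P n) {F. (\<Sum>i<n. ?i (F i)) \<ge> n * (info p + \<delta>)} \<le> exp (- c * n)"
     "\<And>n. n > 0 \<Longrightarrow> measure_pmf.prob (?P n) {F. (\<Sum>i<n. ?i (F i)) \<le> n * (info p - \<delta>)} \<le> exp (- c * n)"
  proof -
    obtain c where "c > 0" and c: "\<forall>n>(0::nat).
       measure_pmf.prob (?P n) {F. (\<Sum>i<n. ?i (F i)) \<ge> n * (info p + \<delta>)} \<le> exp (- c * n) \<and>
       measure_pmf.prob (?P n) {F. (\<Sum>i<n. ?i (F i)) \<le> n * (info p - \<delta>)} \<le> exp (- c * n)"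
      using Hoeffding_iid[OF assms, of "(undefined, undefined)" ?i] unfolding info by blast
    show ?thesis by (rule that[OF \<open>c > 0\<close>]) (use c in auto)
  qed
  have pow: "(\<Prod>i<n. dens p (fst (F i)) (snd (F i))) = 2 powr (\<Sum>i<n. ?i (F i))"
    if F: "F \<in> set_pmf (?P n)" for F n
  proof -
    have "F i \<in> set_pmf p" if "i < n" for i
      using F that by (simp add: set_Pi_pmf PiE_dflt_def)
    then have "dens p (fst (F i)) (snd (F i)) = 2 powr ?i (F i)" if "i < n" for i
      using dens_pos[of "fst (F i)" "snd (F i)" p] that by simp
    then show ?thesis by (simp add: powr_sum)
  qed
  have tr: "measure_pmf.prob (block_pair_pmf n p) {(a, b). Q (dens (block_pair_pmf n p) a b)} =
      measure_pmf.prob (?P n) {F. Q (2 powr (\<Sum>i<n. ?i (F i)))}" for n Q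
  proof -
    have "measure_pmf.prob (block_pair_pmf n p) {(a, b). Q (dens (block_pair_pmf n p) a b)} =
        \<E> (block_pair_pmf n p) (\<lambda>x. of_bool (Q (dens (block_pair_pmf n p) (fst x) (snd x))))"
      unfolding \<E>_of_bool by (simp add: case_prod_unfold)
    also have "\<dots> = \<E> (?P n) (\<lambda>F. of_bool (Q (dens (block_pair_pmf n p) (fst \<circ> F) (snd \<circ> F))))"
      by (subst (1) block_pair_pmf_def) simp
    also have "\<dots> = \<E> (?P n) (\<lambda>F. of_bool (Q (2 powr (\<Sum>i<n. ?i (F i)))))"
      by (intro \<E>_cong) (simp only: dens_block_pair pow)
    also have "\<dots> = measure_pmf.prob (?P n) {F. Q (2 powr (\<Sum>i<n. ?i (F i)))}" by (rule \<E>_of_bool)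
    finally show ?thesis .
  qed
  have lim: "(\<lambda>n. exp (- c * real n)) \<longlonglongrightarrow> 0"
    using LIMSEQ_realpow_zero[of "exp (- c)"] c(1) by (simp add: mult.commute flip: exp_of_nat_mult)
  have "?f n \<le> exp (- c * n)" if "n > 0" for n
    unfolding tr[of n "\<lambda>x. x > 2 powr (n * (info p + \<delta>))"]
    by (rule order.trans[OF measure_pmf.finite_measure_mono c(2)[OF that]]) auto
  then show "?f \<longlonglongrightarrow> 0"
    by (intro tendsto_sandwich[OF _ _ tendsto_const lim] eventually_mono[OF eventually_gt_at_top[of 0]]) auto
  have "?g n \<le> exp (- c * n)" if "n > 0" for n
    unfolding tr[of n "\<lambda>x. x \<le> 2 powr (n * (info p - \<delta>))"]
    by (rule order.trans[OF measure_pmf.finite_measure_mono c(3)[OF that]]) auto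
  then show "?g \<longlonglongrightarrow> 0"
    by (intro tendsto_sandwich[OF _ _ tendsto_const lim] eventually_mono[OF eventually_gt_at_top[of 0]]) auto
qed

section \<open>Mutual information as a finite sum\<close>

lemma mutual_info_eq_info:
  fixes J :: "'a pmf" and A :: "'a \<Rightarrow> 'b::countable" and B :: "'a \<Rightarrow> 'c::countable"
  assumes fin: "finite (set_pmf J)"
  shows "mutual_info J A B = info (map_pmf (\<lambda>\<omega>. (A \<omega>, B \<omega>)) J)"
proof -
  interpret information_space "measure_pmf J" 2
    by unfold_locales simp
  define p where "p = map_pmf (\<lambda>\<omega>. (A \<omega>, B \<omega>)) J"
  have finp: "finite (set_pmf p)" using fin by (simp add: p_def)
  have fst: "map_pmf fst p = map_pmf A J" and snd: "map_pmf snd p = map_pmf B J"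
    by (auto simp: p_def map_pmf_comp)
  have sig: "sigma_finite_measure (count_space (UNIV :: 'b set))" "sigma_finite_measure (count_space (UNIV :: 'c set))"
    by (auto intro: sigma_finite_measure_count_space_countable)
  \<comment> \<open>Countability makes the product of the counting spaces a counting space, so that
    the integral becomes a sum over the support.\<close>
  have pair: "count_space (UNIV :: 'b set) \<Otimes>\<^sub>M count_space (UNIV :: 'c set) = count_space UNIV"
    by (simp add: pair_measure_countable)
  have dist: "distributed (measure_pmf J) (count_space UNIV) X (\<lambda>x. ennreal (pmf (map_pmf X J) x))"
    for X :: "'a \<Rightarrow> 'x"
    unfolding distributed_def
    by (simp flip: map_pmf_rep_eq measure_pmf_eq_density)
  let ?f = "\<lambda>x. pmf p x * log 2 (pmf p x / (pmf (map_pmf A J) (fst x) * pmf (map_pmf B J) (snd x)))"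
  have "mutual_info J A B = integral\<^sup>L (count_space (UNIV :: 'b set) \<Otimes>\<^sub>M count_space (UNIV :: 'c set)) ?f"
    using dist[of "\<lambda>\<omega>. (A \<omega>, B \<omega>)"]
    by (intro mutual_information_distr[OF sig dist _ dist]) (auto simp: pair p_def)
  also have "\<dots> = (\<Sum>x\<in>set_pmf p. ?f x)"
    unfolding pair using finp
    by (intro lebesgue_integral_count_space_finite_support[THEN trans] sum.mono_neutral_left)
      (auto simp: set_pmf_iff intro: finite_subset[OF _ finp])
  also have "\<dots> = info p"
    unfolding info_def using finp
    by (simp add: \<E>_eq_sum dens_def fst snd case_prod_unfold)
  finally show ?thesis by (simp add: p_def)
qed

section \<open>Index sets and exponential rates\<close>

lemma card_index_set:
  assumes "0 \<le> r"
  shows "2 powr (real n * r) / 2 \<le> real (card (index_set n r))"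
    and "real (card (index_set n r)) \<le> 2 powr (real n * r)"
    and "index_set n r \<noteq> {}"
proof -
  let ?x = "2 powr (real n * r)"
  have x: "1 \<le> ?x" using assms ge_one_powr_ge_zero[of 2 "real n * r"] by simp
  then have fl: "1 \<le> \<lfloor>?x\<rfloor>" by (simp add: le_floor_iff)
  then have c: "real (card (index_set n r)) = of_int \<lfloor>?x\<rfloor>" by (simp add: index_set_def)
  \<comment> \<open>Rounding down a number that is at least 1 loses less than a factor of 2.\<close>
  have "?x < of_int \<lfloor>?x\<rfloor> + 1" by linarith
  moreover have "(1::real) \<le> of_int \<lfloor>?x\<rfloor>" using fl by linarith
  ultimately show "?x / 2 \<le> real (card (index_set n r))" unfolding c by linarith
  show "real (card (index_set n r)) \<le> ?x" unfolding c by simp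
  have "1 \<le> nat \<lfloor>?x\<rfloor>" using fl by linarith
  then have "1 \<in> index_set n r" unfolding index_set_def atLeastAtMost_iff by blast
  then show "index_set n r \<noteq> {}" by blast
qed

lemma finite_index_set: "finite (index_set n r)"
  by (simp add: index_set_def)

text \<open>\<open>N\<close> stands for a product of index set sizes, of which only exponential
  bounds up to the constant \<open>c\<close> are available.\<close>

lemma eventually_powr_ratio_le:
  fixes a b c \<eta> :: real
  assumes "0 < c" "a < b" "0 < \<eta>"
  shows "\<forall>\<^sub>F n in sequentially. \<forall>N. c * 2 powr (real n * b) \<le> N \<longrightarrow> 2 powr (real n * a) / N \<le> \<eta>"
proof -
  have "2 powr (a - b) < 1" using assms powr_less_mono[of "a - b" 0 2] by simp
  then have "(\<lambda>n. (2 powr (a - b)) ^ n / c) \<longlonglongrightarrow> 0 / c"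
    using assms by (intro tendsto_divide LIMSEQ_realpow_zero tendsto_const) auto
  then have "\<forall>\<^sub>F n in sequentially. (2 powr (a - b)) ^ n / c < \<eta>"
    using assms by (intro order_tendstoD(2)) auto
  then show ?thesis
  proof (rule eventually_mono, intro allI impI)
    fix n and N :: real
    assume n: "(2 powr (a - b)) ^ n / c < \<eta>" and N: "c * 2 powr (real n * b) \<le> N"
    have pos: "0 < c * 2 powr (real n * b)" using assms by simp
    have "2 powr (real n * a) / N \<le> 2 powr (real n * a) / (c * 2 powr (real n * b))"
      using pos N by (intro divide_left_mono mult_pos_pos[OF _ pos]) auto
    also have "\<dots> = 2 powr (real n * a - real n * b) / c"
      by (simp add: powr_diff)
    also have "2 powr (real n * a - real n * b) = (2 powr (a - b)) ^ n"
      by (simp add: powr_realpow[symmetric] powr_powr right_diff_distrib mult.commute)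
    finally show "2 powr (real n * a) / N \<le> \<eta>" using n by simp
  qed
qed

lemma set_Pi_pmf_seqs: "set_pmf (Pi_pmf {..<n} undefined p) \<subseteq> seqs n"
  using set_Pi_pmf_subset[of "{..<n}" undefined p] by (auto simp: PiE_def extensional_def)

section \<open>Memoryless block codes from a single-letter law\<close>

locale single_letter =
  fixes P :: "('se::finite \<times> 's::finite) pmf"
    and W :: "'x::finite \<Rightarrow> 's \<Rightarrow> ('y::finite \<times> 'z::finite) pmf"
    and PU :: "'se \<Rightarrow> 'u pmf" and PX :: "'u \<Rightarrow> 'se \<Rightarrow> 'x pmf"
    and PSh :: "'x \<Rightarrow> 'se \<Rightarrow> 'z \<Rightarrow> 's pmf"
  assumes finPU1: "\<And>se. finite (set_pmf (PU se))"
begin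

definition joint :: "('se \<times> 's \<times> 'u \<times> 'x \<times> 'y \<times> 'z \<times> 's) pmf" where
  "joint = do {(se, s) \<leftarrow> P; u \<leftarrow> PU se; x \<leftarrow> PX u se; (y, z) \<leftarrow> W x s; sh \<leftarrow> PSh x se z;
     return_pmf (se, s, u, x, y, z, sh)}"

definition rSe :: "'se \<times> 's \<times> 'u \<times> 'x \<times> 'y \<times> 'z \<times> 's \<Rightarrow> 'se" where "rSe = (\<lambda>(se, s, u, x, y, z, sh). se)"
definition rS :: "'se \<times> 's \<times> 'u \<times> 'x \<times> 'y \<times> 'z \<times> 's \<Rightarrow> 's" where "rS = (\<lambda>(se, s, u, x, y, z, sh). s)"
definition rU :: "'se \<times> 's \<times> 'u \<times> 'x \<times> 'y \<times> 'z \<times> 's \<Rightarrow> 'u" where "rU = (\<lambda>(se, s, u, x, y, z, sh). u)"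
definition rY :: "'se \<times> 's \<times> 'u \<times> 'x \<times> 'y \<times> 'z \<times> 's \<Rightarrow> 'y" where "rY = (\<lambda>(se, s, u, x, y, z, sh). y)"
definition rSh :: "'se \<times> 's \<times> 'u \<times> 'x \<times> 'y \<times> 'z \<times> 's \<Rightarrow> 's" where "rSh = (\<lambda>(se, s, u, x, y, z, sh). sh)"

lemmas r_defs = rSe_def rS_def rU_def rY_def rSh_def

definition blockP :: "nat \<Rightarrow> (nat \<Rightarrow> 'se \<times> 's) pmf" where
  "blockP n = Pi_pmf {..<n} (undefined, undefined) (\<lambda>_. P)"

definition blockPU :: "nat \<Rightarrow> (nat \<Rightarrow> 'se) \<Rightarrow> (nat \<Rightarrow> 'u) pmf" where
  "blockPU n se = Pi_pmf {..<n} undefined (\<lambda>i. PU (se i))"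

definition blockPX :: "nat \<Rightarrow> (nat \<Rightarrow> 'u) \<Rightarrow> (nat \<Rightarrow> 'se) \<Rightarrow> (nat \<Rightarrow> 'x) pmf" where
  "blockPX n u se = Pi_pmf {..<n} undefined (\<lambda>i. PX (u i) (se i))"

definition blockPSh :: "nat \<Rightarrow> (nat \<Rightarrow> 'x) \<Rightarrow> (nat \<Rightarrow> 'se) \<Rightarrow> (nat \<Rightarrow> 'z) \<Rightarrow> (nat \<Rightarrow> 's) pmf" where
  "blockPSh n x se z = Pi_pmf {..<n} undefined (\<lambda>i. PSh (x i) (se i) (z i))"

text \<open>The draws follow the order of \<open>code_pmf\<close>, with input and feedback local;
  the law of the final code is then obtained by the monad laws alone.\<close>

definition blockK :: "nat \<Rightarrow> (nat \<Rightarrow> 'u) \<Rightarrow> (nat \<Rightarrow> 'se \<times> 's) \<Rightarrow> ((nat \<Rightarrow> 'y) \<times> (nat \<Rightarrow> 's)) pmf" where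
  "blockK n u a = do {
     x \<leftarrow> blockPX n u (fst \<circ> a);
     yz \<leftarrow> Pi_pmf {..<n} (undefined, undefined) (\<lambda>i. W (x i) (snd (a i)));
     sh \<leftarrow> blockPSh n x (fst \<circ> a) (snd \<circ> yz);
     return_pmf (fst \<circ> yz, sh)}"

lemma finite_joint: "finite (set_pmf joint)"
  unfolding joint_def using finPU1 by (auto simp: case_prod_unfold)

lemma block_one_shot: "one_shot (blockP n) (blockPU n) (blockK n)"
  using finPU1 unfolding blockP_def blockPU_def blockK_def blockPX_def blockPSh_def
  by unfold_locales (auto simp: finite_set_Pi_pmf)

abbreviation dflt :: "'se \<times> 's \<times> 'u \<times> 'x \<times> 'y \<times> 'z \<times> 's" where
  "dflt \<equiv> (undefined, undefined, undefined, undefined, undefined, undefined, undefined)"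

definition blockJ :: "nat \<Rightarrow> (nat \<Rightarrow> 'se \<times> 's \<times> 'u \<times> 'x \<times> 'y \<times> 'z \<times> 's) pmf" where
  "blockJ n = Pi_pmf {..<n} dflt (\<lambda>_. joint)"

text \<open>A product of monadic chains is a chain of products: \<open>Pi_pmf_bind\<close> is peeled
  off once for each variable. The conditional in the last line restores the default tuple outside
  the block.\<close>

lemma blockJ_eq: "blockJ n = do {
    a \<leftarrow> blockP n; u \<leftarrow> blockPU n (fst \<circ> a); x \<leftarrow> blockPX n u (fst \<circ> a);
    yz \<leftarrow> Pi_pmf {..<n} (undefined, undefined) (\<lambda>i. W (x i) (snd (a i)));
    sh \<leftarrow> blockPSh n x (fst \<circ> a) (snd \<circ> yz);
    return_pmf (\<lambda>i. if i \<in> {..<n} then (fst (a i), snd (a i), u i, x i, fst (yz i), snd (yz i), sh i) else dflt)}"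
proof -
  have joint: "joint = bind_pmf P (\<lambda>a. bind_pmf (PU (fst a)) (\<lambda>u. bind_pmf (PX u (fst a)) (\<lambda>x.
     bind_pmf (W x (snd a)) (\<lambda>yz. bind_pmf (PSh x (fst a) (snd yz)) (\<lambda>sh.
     return_pmf (fst a, snd a, u, x, fst yz, snd yz, sh))))))"
    by (simp add: joint_def case_prod_unfold)
  show ?thesis
    unfolding blockJ_def blockP_def blockPU_def blockPX_def blockPSh_def joint o_apply
    apply (subst Pi_pmf_bind[where d' = "(undefined, undefined)"], simp)
    apply (rule bind_pmf_cong[OF refl])
    apply (subst Pi_pmf_bind[where d' = undefined], simp)
    apply (rule bind_pmf_cong[OF refl])
    apply (subst Pi_pmf_bind[where d' = undefined], simp)
    apply (rule bind_pmf_cong[OF refl])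
    apply (subst Pi_pmf_bind[where d' = "(undefined, undefined)"], simp)
    apply (rule bind_pmf_cong[OF refl])
    apply (subst Pi_pmf_bind[where d' = undefined], simp)
    apply (rule bind_pmf_cong[OF refl])
    apply (rule Pi_pmf_return_pmf, simp)
    done
qed

lemma one_shot_J: "one_shot.J (blockP n) (\<lambda>a. fst \<circ> a) (blockPU n) (blockK n) =
  map_pmf (\<lambda>F. (rU \<circ> F, (\<lambda>i. (rSe (F i), rS (F i))), rY \<circ> F, rSh \<circ> F)) (blockJ n)"
proof -
  \<comment> \<open>Outside the block every drawn sequence equals its own default, and there it must
    agree with the projection of the default tuple.\<close>
  have out: "g = (\<lambda>i. if i \<in> {..<n} then g i else c)" if "g \<in> set_pmf (Pi_pmf {..<n} c p)" for g c and p :: "nat \<Rightarrow> 'q pmf"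
    using that set_Pi_pmf_subset[of "{..<n}" c p] by (auto simp: fun_eq_iff)
  show ?thesis
    unfolding one_shot.J_def[OF block_one_shot] blockJ_eq map_bind_pmf map_return_pmf blockK_def
      bind_assoc_pmf bind_return_pmf case_prod_conv
  proof (intro bind_pmf_cong refl arg_cong[of _ _ return_pmf], goal_cases)
    case (1 a u x yz sh)
    then have *: "a i = (undefined, undefined)" "u i = undefined" "yz i = (undefined, undefined)" "sh i = undefined"
      if "i \<notin> {..<n}" for i
      using that out[of a "(undefined, undefined)" "\<lambda>_. P"] out[of u undefined] out[of yz "(undefined, undefined)"]
        out[of sh undefined]
      unfolding blockP_def blockPU_def blockPSh_def by metis+
    show ?case
      using * by (auto simp: r_defs fun_eq_iff prod_eq_iff)
  qed
qed

lemma block_marginals: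
  shows "one_shot.pE (blockP n) (\<lambda>a. fst \<circ> a) (blockPU n) (blockK n) = block_pair_pmf n (map_pmf (\<lambda>\<omega>. (rU \<omega>, rSe \<omega>)) joint)"
    and "one_shot.pY (blockP n) (\<lambda>a. fst \<circ> a) (blockPU n) (blockK n) = block_pair_pmf n (map_pmf (\<lambda>\<omega>. (rU \<omega>, rY \<omega>)) joint)"
    and "one_shot.pT (blockP n) (\<lambda>a. fst \<circ> a) (blockPU n) (blockK n) = block_pair_pmf n (map_pmf (\<lambda>\<omega>. (rU \<omega>, rSh \<omega>)) joint)"
  unfolding one_shot.pE_def[OF block_one_shot] one_shot.pY_def[OF block_one_shot] one_shot.pT_def[OF block_one_shot]
    one_shot_J map_pmf_comp
  by (simp_all add: blockJ_def r_defs block_pair_map[symmetric, where dd = dflt] o_def)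

lemma block_output_law:
  "one_shot.qT (blockP n) (\<lambda>a. fst \<circ> a) (blockPU n) (blockK n) = iid_pmf n (map_pmf rSh joint)"
  unfolding one_shot.qT_def[OF block_one_shot] block_marginals map_snd_block_pair iid_pmf_def map_pmf_comp
  by simp

lemma \<E>_block_distortion:
  assumes "n > 0"
  shows "\<E> (one_shot.J (blockP n) (\<lambda>a. fst \<circ> a) (blockPU n) (blockK n))
      (\<lambda>(u, a, y, t). block_distortion d n (snd \<circ> a) t) = \<E> joint (\<lambda>\<omega>. d (rS \<omega>) (rSh \<omega>))"
proof -
  have "\<E> (blockJ n) (\<lambda>F. \<Sum>i<n. d (rS (F i)) (rSh (F i))) = (\<Sum>i<n. \<E> (blockJ n) (\<lambda>F. d (rS (F i)) (rSh (F i))))"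
    unfolding blockJ_def using finite_joint by (intro \<E>_sum finite_set_Pi_pmf) auto
  also have "\<dots> = (\<Sum>i<n. \<E> joint (\<lambda>\<omega>. d (rS \<omega>) (rSh \<omega>)))"
    unfolding blockJ_def
    by (intro sum.cong refl \<E>_Pi_component[where k = "\<lambda>\<omega>. d (rS \<omega>) (rSh \<omega>)"]) auto
  finally show ?thesis
    using assms by (simp add: one_shot_J block_distortion_def)
qed

theorem achievable_if_rates:
  assumes d: "\<And>s t. 0 \<le> d s t"
    and preserving: "map_pmf rSh joint = map_pmf snd P"
    and nonneg: "0 \<le> R" "0 \<le> Rl" "0 \<le> Rc"
    and cover_Se: "info (map_pmf (\<lambda>\<omega>. (rU \<omega>, rSe \<omega>)) joint) < Rl"
    and cover_Sh: "info (map_pmf (\<lambda>\<omega>. (rU \<omega>, rSh \<omega>)) joint) < R + Rl + Rc"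
    and packing: "R = 0 \<or> R + Rl < info (map_pmf (\<lambda>\<omega>. (rU \<omega>, rY \<omega>)) joint)"
    and D: "\<E> joint (\<lambda>\<omega>. d (rS \<omega>) (rSh \<omega>)) < D"
  shows "achievable P W d D 0 R Rc"
proof -
  define pE where "pE = map_pmf (\<lambda>\<omega>. (rU \<omega>, rSe \<omega>)) joint"
  define pT where "pT = map_pmf (\<lambda>\<omega>. (rU \<omega>, rSh \<omega>)) joint"
  define pY where "pY = map_pmf (\<lambda>\<omega>. (rU \<omega>, rY \<omega>)) joint"
  note p_folds = pE_def[symmetric] pT_def[symmetric] pY_def[symmetric]
  have fin: "finite (set_pmf pE)" "finite (set_pmf pT)" "finite (set_pmf pY)"
    using finite_joint by (auto simp: pE_def pT_def pY_def)
  define B where "B = Max (range (\<lambda>(s, t). d s t))"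
  have B: "d s t \<le> B" for s t
    unfolding B_def by (rule Max_ge) (auto intro: rev_image_eqI[of "(s, t)"])
  have B0: "0 \<le> B" using d B by (meson order_trans)
  define D0 where "D0 = \<E> joint (\<lambda>\<omega>. d (rS \<omega>) (rSh \<omega>))"
  have D0: "0 \<le> D0" "D0 < D" using D d by (auto simp: D0_def intro!: \<E>_nonneg)
  \<comment> \<open>Each threshold exponent lies halfway between the information and the rate: one
    half of the gap is for concentration, the other for the ratio of threshold and codebook size.
    For \<open>R = 0\<close> any positive \<open>\<delta>Y\<close> serves.\<close>
  define \<delta>E where "\<delta>E = (Rl - info pE) / 2"
  define \<delta>T where "\<delta>T = (R + Rl + Rc - info pT) / 2"
  define \<delta>Y where "\<delta>Y = (if R = 0 then 1 else (info pY - (R + Rl)) / 2)"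
  have \<delta>: "\<delta>E > 0" "\<delta>T > 0" "\<delta>Y > 0"
    using cover_Se cover_Sh packing by (auto simp: \<delta>E_def \<delta>T_def \<delta>Y_def p_folds)
  have "\<forall>\<^sub>F n in sequentially. \<exists>c :: ('se, 's, 'x, 'y, 'z) cr_code. is_cr_code n R Rc c \<and>
        (let J = code_pmf P W n R Rc c in
           measure_pmf.prob J {(m, mh, s, sh). m \<noteq> mh} \<le> \<epsilon> \<and>
           measure_pmf.expectation J (\<lambda>(m, mh, s, sh). block_distortion d n s sh) \<le> D \<and>
           total_variation (map_pmf (\<lambda>(m, mh, s, sh). sh) J) (iid_pmf n (map_pmf snd P)) \<le> 0)"
    if "\<epsilon> > 0" for \<epsilon>
  proof -
    \<comment> \<open>The first entry lets the errors pay for the extra distortion, the second makes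
      the error bound \<open>D / k\<close> at most \<open>\<epsilon>\<close>.\<close>
    define k where "k = max (2 * B) (D / \<epsilon>)"
    have k: "k > 0" "2 * B \<le> k" "D / k \<le> \<epsilon>"
    proof -
      have "D / \<epsilon> > 0" using D0 that by simp
      then show "k > 0" by (simp add: k_def)
      moreover have "D / \<epsilon> \<le> k" by (simp add: k_def)
      ultimately show "D / k \<le> \<epsilon>" using that by (simp add: field_simps)
    qed (simp add: k_def)
    \<comment> \<open>The slack \<open>D - D0\<close> is split evenly among the three error terms,
      each weighted by \<open>k\<close>.\<close>
    define \<eta> where "\<eta> = (D - D0) / (3 * k)"
    have \<eta>: "\<eta> > 0" "D0 + k * (\<eta> + \<eta> + \<eta>) \<le> D"
    proof -
      show "\<eta> > 0" using D0 k by (simp add: \<eta>_def)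
      have "k * (\<eta> + \<eta> + \<eta>) = D - D0" using k by (simp add: \<eta>_def field_simps)
      then show "D0 + k * (\<eta> + \<eta> + \<eta>) \<le> D" by simp
    qed
    let ?M = "\<lambda>n. index_set n R" and ?L = "\<lambda>n. index_set n Rl" and ?G = "\<lambda>n. index_set n Rc"
    let ?TE = "\<lambda>n. 2 powr (real n * (info pE + \<delta>E))" and ?TT = "\<lambda>n. 2 powr (real n * (info pT + \<delta>T))"
      and ?TY = "\<lambda>n. 2 powr (real n * (info pY - \<delta>Y))"
    have sq: "x \<le> (\<eta> / 2)\<^sup>2 \<Longrightarrow> sqrt x \<le> \<eta> / 2" for x
      using \<eta> by (intro real_le_lsqrt) auto
    have E1: "\<forall>\<^sub>F n in sequentially. sqrt (?TE n / card (?L n)) \<le> \<eta> / 2"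
    proof -
      have "\<forall>\<^sub>F n in sequentially. \<forall>N. 1/2 * 2 powr (real n * Rl) \<le> N \<longrightarrow> ?TE n / N \<le> (\<eta> / 2)\<^sup>2"
        using \<delta> \<eta> by (intro eventually_powr_ratio_le) (auto simp: \<delta>E_def field_simps)
      then show ?thesis
        by (rule eventually_mono) (use card_index_set(1)[OF nonneg(2)] in \<open>intro sq, simp\<close>)
    qed
    have E2: "\<forall>\<^sub>F n in sequentially. sqrt (?TT n / (card (?M n) * card (?L n) * card (?G n))) \<le> \<eta> / 2"
    proof -
      \<comment> \<open>The constant 1/8 collects the factors 1/2 lost to rounding in the three
        index sets.\<close>
      have "\<forall>\<^sub>F n in sequentially. \<forall>N. 1/8 * 2 powr (real n * (R + Rl + Rc)) \<le> N \<longrightarrow> ?TT n / N \<le> (\<eta> / 2)\<^sup>2"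
        using \<delta> \<eta> by (intro eventually_powr_ratio_le) (auto simp: \<delta>T_def field_simps)
      then show ?thesis
      proof (rule eventually_mono)
        fix n assume *: "\<forall>N. 1/8 * 2 powr (real n * (R + Rl + Rc)) \<le> N \<longrightarrow> ?TT n / N \<le> (\<eta> / 2)\<^sup>2"
        have "1/8 * 2 powr (real n * (R + Rl + Rc)) =
            (2 powr (real n * R) / 2) * (2 powr (real n * Rl) / 2) * (2 powr (real n * Rc) / 2)"
          by (simp add: distrib_left powr_add)
        also have "\<dots> \<le> real (card (?M n)) * real (card (?L n)) * real (card (?G n))"
          using nonneg by (intro mult_mono card_index_set) auto
        finally show "sqrt (?TT n / (card (?M n) * card (?L n) * card (?G n))) \<le> \<eta> / 2"
          using * by (intro sq) simp
      qed
    qed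
    have E3: "\<forall>\<^sub>F n in sequentially. R = 0 \<or> card (?M n) * card (?L n) / ?TY n \<le> \<eta> / 2"
    proof (cases "R = 0")
      case False
      have "\<forall>\<^sub>F n in sequentially. \<forall>N. 1 * ?TY n \<le> N \<longrightarrow> 2 powr (real n * (R + Rl)) / N \<le> \<eta> / 2"
        using \<delta> \<eta> False by (intro eventually_powr_ratio_le) (auto simp: \<delta>Y_def field_simps)
      then show ?thesis
      proof (rule eventually_mono)
        fix n assume *: "\<forall>N. 1 * ?TY n \<le> N \<longrightarrow> 2 powr (real n * (R + Rl)) / N \<le> \<eta> / 2"
        have "real (card (?M n)) * real (card (?L n)) \<le> 2 powr (real n * R) * 2 powr (real n * Rl)"
          using nonneg by (intro mult_mono card_index_set) auto
        also have "\<dots> = 2 powr (real n * (R + Rl))" by (simp add: distrib_left powr_add)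
        finally have "real (card (?M n) * card (?L n)) / ?TY n \<le> 2 powr (real n * (R + Rl)) / ?TY n"
          by (intro divide_right_mono) auto
        also have "\<dots> \<le> \<eta> / 2" using * by simp
        finally show "R = 0 \<or> card (?M n) * card (?L n) / ?TY n \<le> \<eta> / 2" by simp
      qed
    qed simp
    \<comment> \<open>Soft covering doubles the tail: \<open>\<eta> / 2\<close> from the root and
      twice \<open>\<eta> / 4\<close> from the tail add up to \<open>\<eta>\<close>.\<close>
    have F1: "\<forall>\<^sub>F n in sequentially. measure_pmf.prob (block_pair_pmf n pE)
        {(a, b). dens (block_pair_pmf n pE) a b > ?TE n} < \<eta> / 4"
      using \<eta> \<delta> by (intro order_tendstoD(2)[OF prob_block_dens(1)[OF fin(1)]]) auto
    have F2: "\<forall>\<^sub>F n in sequentially. measure_pmf.prob (block_pair_pmf n pT)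
        {(a, b). dens (block_pair_pmf n pT) a b > ?TT n} < \<eta> / 4"
      using \<eta> \<delta> by (intro order_tendstoD(2)[OF prob_block_dens(1)[OF fin(2)]]) auto
    have F3: "\<forall>\<^sub>F n in sequentially. measure_pmf.prob (block_pair_pmf n pY)
        {(a, b). dens (block_pair_pmf n pY) a b \<le> ?TY n} < \<eta> / 2"
      using \<eta> \<delta> by (intro order_tendstoD(2)[OF prob_block_dens(2)[OF fin(3)]]) auto
    show ?thesis
      using E1 E2 E3 F1 F2 F3 eventually_gt_at_top[of 0]
    proof eventually_elim
      case (elim n)
      let ?P = "blockP n" and ?K = "blockK n" and ?e = "\<lambda>a. fst \<circ> a"
      interpret rc: random_code ?P ?e "blockPU n" ?K "?M n" "?L n" "?G n" undefined
        unfolding random_code_def random_code_axioms_def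
        using block_one_shot finite_index_set card_index_set(3) nonneg by simp
      have block: "rc.pE = block_pair_pmf n pE" "rc.pY = block_pair_pmf n pY" "rc.pT = block_pair_pmf n pT"
        unfolding block_marginals pE_def pY_def pT_def by simp_all
      have qT: "rc.qT = iid_pmf n (map_pmf snd P)"
        unfolding block_output_law preserving ..
      have bd: "0 \<le> block_distortion d n s t" "block_distortion d n s t \<le> B" for s t
      proof -
        show "0 \<le> block_distortion d n s t"
          unfolding block_distortion_def by (intro divide_nonneg_nonneg sum_nonneg d) simp
        show "block_distortion d n s t \<le> B"
          unfolding block_distortion_def
          using average_le_const[of "{..<n}" "\<lambda>i. d (s i) (t i)" B] B elim by auto
      qed
      have c1: "sqrt (?TE n / card (?L n)) + 2 * measure_pmf.prob rc.pE {(a, b). dens rc.pE a b > ?TE n} \<le> \<eta>"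
        using elim unfolding block by linarith
      have c2: "sqrt (?TT n / (card (?M n) * card (?L n) * card (?G n))) +
          2 * measure_pmf.prob rc.pT {(a, b). dens rc.pT a b > ?TT n} \<le> \<eta>"
        using elim unfolding block by linarith
      have c3: "card (?M n) = 1 \<and> 0 \<le> \<eta> \<or>
         measure_pmf.prob rc.pY {(a, b). dens rc.pY a b \<le> ?TY n} + card (?M n) * card (?L n) / ?TY n \<le> \<eta>"
      proof (cases "R = 0")
        case True
        \<comment> \<open>At rate 0 the message set is \<open>{1}\<close>, so the first alternative
          holds.\<close>
        then show ?thesis using \<eta> by (simp add: index_set_def)
      next
        case False
        then show ?thesis using elim unfolding block by linarith
      qed
      have c4: "\<E> rc.J (\<lambda>(u, a, y, t). block_distortion d n (snd \<circ> a) t) + k * (\<eta> + \<eta> + \<eta>) \<le> D"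
        using \<E>_block_distortion[of n d] elim \<eta> by (simp add: D0_def)
      have Tpos: "0 < ?TE n" "0 < ?TT n" "0 < ?TY n" by simp_all
      obtain C :: "nat \<times> nat \<times> nat \<Rightarrow> nat \<Rightarrow> 'u" and lk dc \<kappa> Q where dc: "\<And>y g. dc y g \<in> ?M n"
        and \<kappa>: "\<And>x. set_pmf (\<kappa> x) \<subseteq> insert x (set_pmf rc.qT)"
        and Q: "Q = do {m \<leftarrow> pmf_of_set (?M n); g \<leftarrow> pmf_of_set (?G n); a \<leftarrow> ?P; l \<leftarrow> lk m g (?e a);
           (y, t) \<leftarrow> ?K (C (m, l, g)) a; t' \<leftarrow> \<kappa> t; return_pmf (m, dc y g, a, t')}"
        and Q_T: "map_pmf (\<lambda>(m, m', a, t). t) Q = rc.qT"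
        and Q_err: "\<E> Q (\<lambda>(m, m', a, t). of_bool (m \<noteq> m')) \<le> D / k"
        and Q_dist: "\<E> Q (\<lambda>(m, m', a, t). block_distortion d n (snd \<circ> a) t) \<le> D"
        by (rule rc.one_shot_code[where \<delta> = "\<lambda>a t. block_distortion d n (snd \<circ> a) t",
              OF bd Tpos k(1,2) c1 c2 c3 c4]) (rule that; assumption)
      \<comment> \<open>The bin choice is absorbed into the stochastic encoder. The estimator does
        not see the codeword: it works letter by letter from input, side information and feedback,
        and then applies the coupling kernel to its own output.\<close>
      define c :: "('se, 's, 'x, 'y, 'z) cr_code" where
        "c = \<lparr>enc = (\<lambda>m se g. bind_pmf (lk m g se) (\<lambda>l. blockPX n (C (m, l, g)) se)), dec = dc,
            est = (\<lambda>g x se z. bind_pmf (blockPSh n x se z) \<kappa>)\<rparr>"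
      have "is_cr_code n R Rc c"
      proof -
        \<comment> \<open>The kernel returns its argument or a point in the support of the target
          law, so no value outside the block is disturbed.\<close>
        have "set_pmf (\<kappa> x) \<subseteq> seqs n" if "x \<in> seqs n" for x
          using \<kappa>[of x] that set_Pi_pmf_seqs[of n "\<lambda>_. map_pmf snd P"] unfolding qT iid_pmf_def by blast
        then have "set_pmf (bind_pmf (blockPSh n x se z) \<kappa>) \<subseteq> seqs n" for x se z
          using set_Pi_pmf_seqs[of n] unfolding blockPSh_def set_bind_pmf by blast
        moreover have "set_pmf (bind_pmf (lk m g se) (\<lambda>l. blockPX n (C (m, l, g)) se)) \<subseteq> seqs n" for m g se
          using set_Pi_pmf_seqs[of n] unfolding blockPX_def set_bind_pmf by blast
        ultimately show ?thesis using dc by (simp add: is_cr_code_def c_def)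
      qed
      moreover have law: "code_pmf P W n R Rc c = map_pmf (\<lambda>(m, m', a, t). (m, m', snd \<circ> a, t)) Q"
        unfolding code_pmf_def Q blockK_def c_def blockP_def
        by (simp add: map_bind_pmf bind_assoc_pmf bind_return_pmf case_prod_unfold)
      moreover have "measure_pmf.prob (code_pmf P W n R Rc c) {(m, mh, s, sh). m \<noteq> mh} \<le> \<epsilon>"
      proof -
        have "measure_pmf.prob (code_pmf P W n R Rc c) {(m, mh, s, sh). m \<noteq> mh} =
            \<E> (code_pmf P W n R Rc c) (\<lambda>x. of_bool (fst x \<noteq> fst (snd x)))"
          unfolding \<E>_of_bool by (simp add: case_prod_unfold)
        also have "\<dots> = \<E> Q (\<lambda>(m, m', a, t). of_bool (m \<noteq> m'))"
          unfolding law by (simp add: case_prod_unfold)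
        finally show ?thesis using Q_err k by linarith
      qed
      moreover have "measure_pmf.expectation (code_pmf P W n R Rc c) (\<lambda>(m, mh, s, sh). block_distortion d n s sh) \<le> D"
        using Q_dist unfolding law by (simp add: case_prod_unfold)
      moreover have "total_variation (map_pmf (\<lambda>(m, mh, s, sh). sh) (code_pmf P W n R Rc c)) (iid_pmf n (map_pmf snd P)) \<le> 0"
        using Q_T unfolding total_variation_le_0_iff law qT[symmetric]
        by (simp add: map_pmf_comp case_prod_unfold)
      ultimately show ?case by (auto simp: Let_def)
    qed
  qed
  then show ?thesis using nonneg by (simp add: achievable_def)
qed

end

section \<open>Slack in the rates and passage to the closure\<close>

lemma dist_triple_le:
  fixes a b c a' b' c' :: real
  shows "dist (a, b, c) (a', b', c') \<le> \<bar>a - a'\<bar> + \<bar>b - b'\<bar> + \<bar>c - c'\<bar>"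
proof -
  have pair: "dist (x, y) (x', y') \<le> dist x x' + dist y y'"
    for x x' :: real and y y' :: "'v::metric_space"
    unfolding dist_Pair_Pair by (rule sqrt_sum_squares_le_sum) auto
  show ?thesis
    using pair[of a "(b, c)" a' "(b', c')"] pair[of b c b' c'] by (simp add: dist_real_def)
qed

theorem theorem1:
  fixes P :: "('se::finite \<times> 's::finite) pmf"
    and W :: "'x::finite \<Rightarrow> 's \<Rightarrow> ('y::finite \<times> 'z::finite) pmf"
    and d :: "'s \<Rightarrow> 's \<Rightarrow> real"
    and D :: real
  assumes "\<And>s t. 0 \<le> d s t"
    and "0 \<le> D"
  shows "inner_region P W d D \<subseteq> capacity_distortion_region P W d D"
proof clarify
  fix R Rc
  assume "(R, Rc) \<in> inner_region P W d D"
  then obtain \<J> where nonneg: "0 \<le> R" "0 \<le> Rc" and \<J>: "\<J> \<in> preserving_joint_laws P W"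
    and rate: "R \<le> mutual_info \<J> (\<lambda>(se, s, u, x, y, z, sh). u) (\<lambda>(se, s, u, x, y, z, sh). y)
        - mutual_info \<J> (\<lambda>(se, s, u, x, y, z, sh). u) (\<lambda>(se, s, u, x, y, z, sh). se)"
    and cr: "max (mutual_info \<J> (\<lambda>(se, s, u, x, y, z, sh). u) (\<lambda>(se, s, u, x, y, z, sh). sh)
        - mutual_info \<J> (\<lambda>(se, s, u, x, y, z, sh). u) (\<lambda>(se, s, u, x, y, z, sh). y)) 0 \<le> Rc"
    and dist: "\<E> \<J> (\<lambda>\<omega>. d ((\<lambda>(se, s, u, x, y, z, sh). s) \<omega>) ((\<lambda>(se, s, u, x, y, z, sh). sh) \<omega>)) \<le> D"
    unfolding inner_region_def Let_def by blast
  obtain \<U> PU PX PSh where \<U>: "finite \<U>" "\<And>se. set_pmf (PU se) \<subseteq> \<U>"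
    and \<J>_eq: "\<J> = do {(se, s) \<leftarrow> P; u \<leftarrow> PU se; x \<leftarrow> PX u se; (y, z) \<leftarrow> W x s; sh \<leftarrow> PSh x se z;
       return_pmf (se, s, u, x, y, z, sh)}"
    using \<J> unfolding preserving_joint_laws_def joint_laws_def by blast
  interpret single_letter P W PU PX PSh
    using \<U> finite_subset by unfold_locales blast
  have \<J>_joint: "\<J> = joint" unfolding \<J>_eq joint_def ..
  have preserving: "map_pmf rSh joint = map_pmf snd P"
    using \<J> unfolding preserving_joint_laws_def \<J>_joint rSh_def by blast
  define IE where "IE = info (map_pmf (\<lambda>\<omega>. (rU \<omega>, rSe \<omega>)) joint)"
  define IY where "IY = info (map_pmf (\<lambda>\<omega>. (rU \<omega>, rY \<omega>)) joint)"
  define IT where "IT = info (map_pmf (\<lambda>\<omega>. (rU \<omega>, rSh \<omega>)) joint)"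
  have IE0: "0 \<le> IE" unfolding IE_def using finite_joint by (intro info_nonneg) simp
  have rate: "R \<le> IY - IE" and cr: "IT - IY \<le> Rc"
    using rate cr unfolding \<J>_joint r_defs[symmetric] IE_def IY_def IT_def
    by (simp_all add: mutual_info_eq_info[OF finite_joint])
  have dist: "\<E> joint (\<lambda>\<omega>. d (rS \<omega>) (rSh \<omega>)) \<le> D"
    using dist unfolding \<J>_joint r_defs[symmetric] .
  have "\<exists>y\<in>{(R', Rc', D'). achievable P W d D' 0 R' Rc'}. dist y (R, Rc, D) < e" if "e > 0" for e
  proof -
    \<comment> \<open>The three coordinates move by at most \<open>4 * \<delta>\<close>,
      \<open>4 * \<delta>\<close> and \<open>\<delta>\<close>, hence
      \<open>9 * \<delta> < e\<close>; the bound \<open>R / 8\<close> keeps a positive rate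
      positive.\<close>
    define \<delta> where "\<delta> = min (e / 20) (if R = 0 then 1 else R / 8)"
    have \<delta>: "\<delta> > 0" "9 * \<delta> < e" "R \<noteq> 0 \<Longrightarrow> 4 * \<delta> < R"
      using that nonneg by (auto simp: \<delta>_def min_def)
    \<comment> \<open>If \<open>R = 0\<close>, nothing has to be decoded, so that the bin rate \<open>Rl\<close> may exceed \<open>I(U;Y)\<close>; this is
       needed when \<open>I(U;Y) = I(U;S_e)\<close>.\<close>
    define R' where "R' = (if R = 0 then 0 else R - 4 * \<delta>)"
    define Rl where "Rl = IY - R' + (if R = 0 then 2 * \<delta> else - 2 * \<delta>)"
    \<comment> \<open>For positive \<open>R\<close>, half of the \<open>4 * \<delta>\<close> taken
      off it separates \<open>R' + Rl\<close> from \<open>IY\<close> and the other half separates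
      \<open>Rl\<close> from \<open>IE\<close>. The \<open>4 * \<delta>\<close> added to
      \<open>Rc\<close> outweighs the first half, so the total rate exceeds
      \<open>IT\<close>.\<close>
    have "achievable P W d (D + \<delta>) 0 R' (Rc + 4 * \<delta>)"
    proof (rule achievable_if_rates[OF assms(1) preserving])
      show "0 \<le> R'" "0 \<le> Rl" "0 \<le> Rc + 4 * \<delta>"
        using nonneg rate \<delta> IE0 by (auto simp: R'_def Rl_def)
      show "info (map_pmf (\<lambda>\<omega>. (rU \<omega>, rSe \<omega>)) joint) < Rl"
        "info (map_pmf (\<lambda>\<omega>. (rU \<omega>, rSh \<omega>)) joint) < R' + Rl + (Rc + 4 * \<delta>)"
        using rate cr \<delta> unfolding IE_def[symmetric] IT_def[symmetric] by (auto simp: R'_def Rl_def)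
      show "R' = 0 \<or> R' + Rl < info (map_pmf (\<lambda>\<omega>. (rU \<omega>, rY \<omega>)) joint)"
        using \<delta> unfolding IY_def[symmetric] by (auto simp: R'_def Rl_def)
      show "\<E> joint (\<lambda>\<omega>. d (rS \<omega>) (rSh \<omega>)) < D + \<delta>" using dist \<delta> by simp
    qed
    moreover have "dist (R', Rc + 4 * \<delta>, D + \<delta>) (R, Rc, D) < e"
      using dist_triple_le[of R' "Rc + 4 * \<delta>" "D + \<delta>" R Rc D] \<delta>
      by (auto simp: R'_def split: if_splits)
    ultimately show ?thesis by (intro bexI[of _ "(R', Rc + 4 * \<delta>, D + \<delta>)"]) simp_all
  qed
  then show "(R, Rc) \<in> capacity_distortion_region P W d D"
    unfolding capacity_distortion_region_def by (simp only: mem_Collect_eq case_prod_conv closure_approachable) blast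
qed



end
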